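(* For every integer $k\ge 1$ there exists a planar triangulation $G$ on $52k$ vertices with $a(G)\le 25k$ such that, for every integer $d\ge 7$, $$f_d(G)\le 25k<\frac{2\cdot d\cdot 52k}{4d+1}.$$ In particular, for every integer $d\ge 7$ there are infinitely many pairwise non-isomorphic planar graphs $G$ for which the inequality $f_d(G)>\frac{2d\,|V(G)|}{4d+1}$ (conjectured by Chappell and Pelsmajer for all planar graphs $G$ and all integers $d\ge 2$) fails.
   Context: All graphs are finite, simple and non-empty. For a graph $G$, $a(G)$ denotes the maximum of $|F|$ over all $F\subseteq V(G)$ such that the induced subgraph $G[F]$ is a forest (acyclic). For an integer $d\ge 2$, $f_d(G)$ denotes the maximum of $|F|$ over all $F\subseteq V(G)$ such that $G[F]$ is a forest of maximum degree at most $d$. A planar triangulation is a simple planar graph that has a planar embedding in which every face (including the outer one) is a triangle. *)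

theory Defs
  imports "HOL-Analysis.Analysis"
begin

text \<open>A graph is a pair of a vertex set and a set of edges, an edge being the set of its two ends.\<close>

type_synonym 'a ugraph = "'a set \<times> 'a set set"

abbreviation verts :: "'a ugraph \<Rightarrow> 'a set" where "verts G \<equiv> fst G"

abbreviation edges :: "'a ugraph \<Rightarrow> 'a set set" where "edges G \<equiv> snd G"

definition simple_graph :: "'a ugraph \<Rightarrow> bool" where
  "simple_graph G \<longleftrightarrow>
     finite (verts G) \<and> verts G \<noteq> {} \<and> (\<forall>e\<in>edges G. e \<subseteq> verts G \<and> card e = 2)"

definition graph_iso :: "'a ugraph \<Rightarrow> 'b ugraph \<Rightarrow> bool" where
  "graph_iso G H \<longleftrightarrow>
     (\<exists>\<phi>. bij_betw \<phi> (verts G) (verts H) \<and>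
        (\<forall>u\<in>verts G. \<forall>v\<in>verts G. {u, v} \<in> edges G \<longleftrightarrow> {\<phi> u, \<phi> v} \<in> edges H))"

definition induced :: "'a ugraph \<Rightarrow> 'a set \<Rightarrow> 'a ugraph" where
  "induced G F = (F, {e \<in> edges G. e \<subseteq> F})"

definition degree :: "'a ugraph \<Rightarrow> 'a \<Rightarrow> nat" where
  "degree G v = card {e \<in> edges G. v \<in> e}"

definition is_cycle :: "'a ugraph \<Rightarrow> 'a list \<Rightarrow> bool" where
  "is_cycle G p \<longleftrightarrow>
     3 \<le> length p \<and> distinct p \<and> set p \<subseteq> verts G \<and>
     (\<forall>i<length p. {p ! i, p ! (Suc i mod length p)} \<in> edges G)"

definition forest :: "'a ugraph \<Rightarrow> bool" where
  "forest G \<longleftrightarrow> (\<nexists>p. is_cycle G p)"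

text \<open>The sets below always contain \<open>0\<close>, from \<open>F = {}\<close>, so the maxima exist for finite graphs.\<close>

definition max_forest :: "'a ugraph \<Rightarrow> nat" where
  "max_forest G = Max {card F | F. F \<subseteq> verts G \<and> forest (induced G F)}"

definition max_forest_deg :: "nat \<Rightarrow> 'a ugraph \<Rightarrow> nat" where
  "max_forest_deg d G =
     Max {card F | F. F \<subseteq> verts G \<and> forest (induced G F) \<and>
                      (\<forall>v\<in>F. degree (induced G F) v \<le> d)}"

text \<open>The plane is \<^typ>\<open>complex\<close>. Vertices go to distinct points and edges to arcs
  between their ends, which meet the vertices and each other only in common ends.\<close>

definition plane_embedding ::
    "'a ugraph \<Rightarrow> ('a \<Rightarrow> complex) \<Rightarrow> ('a set \<Rightarrow> real \<Rightarrow> complex) \<Rightarrow> bool" where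
  "plane_embedding G pos \<gamma> \<longleftrightarrow>
     inj_on pos (verts G) \<and>
     (\<forall>e\<in>edges G. arc (\<gamma> e) \<and> {pathstart (\<gamma> e), pathfinish (\<gamma> e)} = pos ` e) \<and>
     (\<forall>e\<in>edges G. path_image (\<gamma> e) \<inter> pos ` verts G = pos ` e) \<and>
     (\<forall>e\<in>edges G. \<forall>e'\<in>edges G. e \<noteq> e' \<longrightarrow>
        path_image (\<gamma> e) \<inter> path_image (\<gamma> e') = pos ` (e \<inter> e'))"

definition drawing ::
    "'a ugraph \<Rightarrow> ('a \<Rightarrow> complex) \<Rightarrow> ('a set \<Rightarrow> real \<Rightarrow> complex) \<Rightarrow> complex set" where
  "drawing G pos \<gamma> = pos ` verts G \<union> (\<Union>e\<in>edges G. path_image (\<gamma> e))"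

definition faces ::
    "'a ugraph \<Rightarrow> ('a \<Rightarrow> complex) \<Rightarrow> ('a set \<Rightarrow> real \<Rightarrow> complex) \<Rightarrow> complex set set" where
  "faces G pos \<gamma> = components (- drawing G pos \<gamma>)"

text \<open>The three arcs form a Jordan curve, so a face with this frontier is one of its two sides.\<close>

definition triangular_face :: "'a ugraph \<Rightarrow> ('a set \<Rightarrow> real \<Rightarrow> complex) \<Rightarrow> complex set \<Rightarrow> bool" where
  "triangular_face G \<gamma> C \<longleftrightarrow>
     (\<exists>u v w. distinct [u, v, w] \<and> {{u, v}, {v, w}, {u, w}} \<subseteq> edges G \<and>
        frontier C = path_image (\<gamma> {u, v}) \<union> path_image (\<gamma> {v, w}) \<union> path_image (\<gamma> {u, w}))"

definition planar :: "'a ugraph \<Rightarrow> bool" where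
  "planar G \<longleftrightarrow> simple_graph G \<and> (\<exists>pos \<gamma>. plane_embedding G pos \<gamma>)"

definition planar_triangulation :: "'a ugraph \<Rightarrow> bool" where
  "planar_triangulation G \<longleftrightarrow>
     simple_graph G \<and>
     (\<exists>pos \<gamma>. plane_embedding G pos \<gamma> \<and> (\<forall>C\<in>faces G pos \<gamma>. triangular_face G \<gamma> C))"

end

theory Submission
  imports Defs
begin

text \<open>One plane triangulation with 52 vertices and no induced forest on more than 25 of them
carries everything: \<open>k\<close> copies are nested inside each other, and an induced forest of the
result restricts to an induced forest of every copy. Since \<open>25 * (4 * d + 1) < 104 * d\<close> exactly for
\<open>4 * d > 25\<close>, such a graph violates the conjectured bound from \<open>d = 7\<close> on.

The building block is a triangulation on 17 vertices with a distinguished edge \<open>ab\<close>, in which an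
induced forest that omits \<open>a\<close> or \<open>b\<close> has at most 8 vertices, and hence any induced forest has at
most 9 (\<open>block_bound\<close>). The complement of a forest meets every cycle, and omitting \<open>a\<close> or \<open>b\<close> means
that it also meets \<open>{a, b}\<close>; so the claim is that a family of short cycles together with
\<open>{a, b}\<close> has no hitting set of size 8, which a small verified search decides
(\<open>unhittable_card\<close>, \<open>block_unhittable\<close>).

Three blocks are glued to a frame with seven vertices: a triangle \<open>b1 b2 b3\<close>, a centre \<open>v\<close>, and
\<open>a1\<close>, \<open>a2\<close>, \<open>a3\<close>, where \<open>v\<close> is joined to all others and the \<open>i\<close>-th block has \<open>ai bi\<close> as its
distinguished edge. This makes \<open>7 + 3 * 15 = 52\<close> vertices. A forest contains at most 8 vertices of each
block, one more for each distinguished edge that it contains, and possibly \<open>v\<close>. But \<open>v\<close> forms a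
triangle with every distinguished edge, and the four ends of two distinguished edges also span a
triangle. So at most one of these extra vertices is present, and \<open>3 * 8 + 1 = 25\<close> (\<open>insert_unit\<close>).

All graphs are drawn with straight edges, starting from one triangle, by two moves: put a new
vertex into a bounded face and join it to the corners, or exchange the diagonal of a convex
quadrilateral formed by two faces. Both moves preserve the invariant \<open>triangulated\<close>, from which the
topological definition of a triangulation follows (\<open>triangulated_planar_triangulation\<close>). A
sequence of moves that works for integer points in one triangle works, by an affine
map, in every face of every drawing (\<open>insert_drawn\<close>).\<close>

section \<open>Hitting sets\<close>

text \<open>A greedy packing: disjoint members of \<open>H\<close> need different elements of a hitting set. The list \<open>U\<close>
collects what the members chosen so far occupy.\<close>

fun packs :: "nat \<Rightarrow> nat list \<Rightarrow> nat list list \<Rightarrow> bool" where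
  "packs 0 U H = True"
| "packs (Suc k) U [] = False"
| "packs (Suc k) U (h # H) =
     (if list_all (\<lambda>x. x \<notin> set U) h then packs k (h @ U) H else packs (Suc k) U H)"

text \<open>A hitting set meets the edge \<open>v # vs\<close>. Either it contains \<open>v\<close>, and the edges through \<open>v\<close> are
done with, or it does not, and \<open>v\<close> can be deleted from all edges. The test \<open>f\<close> has to refute the
first case for every vertex of the edge in turn.\<close>

fun branch :: "(nat list list \<Rightarrow> bool) \<Rightarrow> nat list \<Rightarrow> nat list list \<Rightarrow> bool" where
  "branch f [] H = True"
| "branch f (v # vs) H =
     (f (filter (\<lambda>h. v \<notin> set h) H) \<and> branch f vs (map (filter (\<lambda>x. x \<noteq> v)) H))"

text \<open>Shortest edges come first, for the benefit of both the greedy packing and the branching.\<close>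

primrec unhittable :: "nat \<Rightarrow> nat list list \<Rightarrow> bool" where
  "unhittable 0 H = packs 1 [] H"
| "unhittable (Suc k) H = (let S = sort_key length H in
     packs (Suc (Suc k)) [] S \<or> (case S of [] \<Rightarrow> False | h # _ \<Rightarrow> branch (unhittable k) h S))"

definition hits :: "nat set \<Rightarrow> nat list list \<Rightarrow> bool" where
  "hits X H \<longleftrightarrow> (\<forall>h\<in>set H. set h \<inter> X \<noteq> {})"

lemma packs_card:
  "packs k U H \<Longrightarrow> finite X \<Longrightarrow> hits X H \<Longrightarrow> k \<le> card (X - set U)"
proof (induction k U H rule: packs.induct)
  case (3 k U h H)
  show ?case
  proof (cases "list_all (\<lambda>x. x \<notin> set U) h")
    case True
    obtain x where x: "x \<in> set h" "x \<in> X" using 3(5) by (auto simp: hits_def)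
    have "x \<notin> set U" using True x by (auto simp: list_all_iff)
    then have "insert x (X - set (h @ U)) \<subseteq> X - set U" using x by auto
    moreover have "card (insert x (X - set (h @ U))) = Suc (card (X - set (h @ U)))"
      using x 3(4) by (simp add: card_insert_if)
    ultimately have "Suc (card (X - set (h @ U))) \<le> card (X - set U)"
      using 3(4) by (metis card_mono finite_Diff)
    moreover have "k \<le> card (X - set (h @ U))"
      using 3 True by (simp add: hits_def)
    ultimately show ?thesis by simp
  next
    case False
    then show ?thesis using 3(2-) by (auto simp: hits_def)
  qed
qed auto

lemma branch_step:
  "branch f vs H \<Longrightarrow> hits X H \<Longrightarrow> set vs \<inter> X \<noteq> {} \<Longrightarrow>
     \<exists>v\<in>X. \<exists>H'. f H' \<and> hits (X - {v}) H'"
proof (induction f vs H rule: branch.induct)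
  case (2 f v vs H)
  show ?case
  proof (cases "v \<in> X")
    case True
    have "hits (X - {v}) (filter (\<lambda>h. v \<notin> set h) H)"
      using 2(3) by (fastforce simp: hits_def)
    then show ?thesis using 2(2) True by auto
  next
    case False
    have "hits X (map (filter (\<lambda>x. x \<noteq> v)) H)"
      using 2(3) False by (fastforce simp: hits_def)
    then show ?thesis using 2 False by auto
  qed
qed auto

lemma unhittable_card:
  "unhittable k H \<Longrightarrow> finite X \<Longrightarrow> hits X H \<Longrightarrow> k < card X"
proof (induction k arbitrary: H X)
  case 0
  then show ?case using packs_card[of 1 "[]" H X] by simp
next
  case (Suc k)
  define S where "S = sort_key length H"
  have hS: "hits X S" using Suc.prems(3) by (simp add: S_def hits_def)
  consider (a) "packs (Suc (Suc k)) [] S" | (b) h T where "S = h # T" "branch (unhittable k) h S"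
    using Suc.prems(1) by (auto simp: S_def[symmetric] Let_def split: list.splits)
  then show ?case
  proof cases
    case a
    then show ?thesis using packs_card[of "Suc (Suc k)" "[]" S X] hS Suc.prems(2) by simp
  next
    case b
    then have "set h \<inter> X \<noteq> {}" using hS by (simp add: hits_def)
    from branch_step[OF b(2) hS this] obtain v H' where v: "v \<in> X" "unhittable k H'" "hits (X - {v}) H'"
      by auto
    then have "k < card (X - {v})" using Suc.IH[of H' "X - {v}"] Suc.prems(2) by auto
    then show ?thesis using v(1) Suc.prems(2) by (simp add: card_Diff_singleton)
  qed
qed

section \<open>The block on 17 vertices\<close>

text \<open>The distinguished edge joins 0 and 1. The number 2 is reserved for the third corner
of the face into which the block is drawn, a vertex that does not belong to the block.\<close>

definition block_edges :: "(nat \<times> nat) list" where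
  "block_edges = [
    (0,1), (0,3), (0,5), (0,6), (1,3), (1,6), (1,7), (3,5), (3,7), (3,8), (3,11), (4,6), (4,7),
    (4,10), (4,11), (4,16), (4,17), (5,6), (5,8), (5,9), (5,10), (6,7), (6,10), (7,11), (8,9),
    (8,11), (8,12), (8,13), (9,10), (9,13), (9,14), (10,14), (10,17), (11,12), (11,16), (12,13),
    (12,15), (12,16), (13,14), (13,15), (14,15), (14,17), (15,16), (15,17), (16,17)
  ]"

text \<open>The induced cycles of the block that the search in \<open>block_unhittable\<close> uses.\<close>

definition block_cycles :: "nat list list" where
  "block_cycles = [
    [10,14,9], [7,1,3], [8,3,5], [17,4,16], [14,9,13], [6,0,5], [7,11,3], [4,7,11], [6,7,4],
    [14,15,17], [11,12,8], [11,12,16], [3,8,11], [10,4,6], [13,8,12], [15,16,17], [4,10,17],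
    [8,9,5], [13,8,9], [12,15,16], [10,5,9], [5,6,10], [16,4,11], [17,10,14], [5,0,3],
    [15,12,13], [14,15,13], [7,1,6], [6,0,3,7], [5,6,1,3], [5,6,7,3], [12,13,14,17,16],
    [6,4,11,3,5], [5,10,4,7,3], [6,7,11,8,5], [10,17,15,13,9], [4,6,1,3,11], [5,8,13,14,10],
    [11,16,15,13,8], [14,15,16,4,10], [11,4,6,0,3], [11,12,15,17,4], [6,5,8,11,4],
    [14,15,12,8,9], [15,16,4,10,9,13], [16,4,10,5,8,12], [16,12,8,9,14,17], [10,17,15,12,8,9],
    [3,8,9,10,6,1], [17,10,5,8,13,15], [17,16,11,8,9,14], [7,4,10,9,8,3], [11,4,10,14,13,12],
    [9,10,17,16,12,8], [13,9,10,17,16,12], [11,16,17,10,5,8], [10,6,7,11,16,17],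
    [7,11,8,9,10,6], [14,13,8,11,16,17], [8,12,15,14,10,5], [9,14,17,4,6,5], [13,12,11,3,5,9],
    [15,12,11,4,10,14], [8,3,7,4,16,12], [8,9,14,15,16,11], [13,14,17,4,11,12], [8,9,10,6,0,3],
    [16,4,10,9,13,12], [8,9,14,17,4,11], [14,13,12,16,4,10], [9,13,12,11,4,6,5],
    [14,10,5,8,11,16,15], [13,8,3,7,4,16,15], [5,9,14,15,12,11,3], [11,8,13,14,10,6,7],
    [12,8,3,7,4,17,15], [6,7,11,16,15,14,10], [9,14,17,4,11,3,5], [6,5,9,13,15,17,4],
    [14,9,8,3,7,4,17], [15,16,4,10,5,8,13], [16,17,10,6,0,3,11], [14,13,8,3,7,4,10],
    [4,6,1,3,8,12,16], [3,11,16,17,10,6,1], [15,17,10,6,7,11,12], [3,8,12,16,4,6,0],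
    [9,10,6,7,11,12,13], [4,11,3,5,9,13,15,17], [14,17,4,6,0,3,8,9], [15,14,9,8,3,7,4,16],
    [4,6,5,9,14,15,12,11], [10,14,15,12,8,3,7,4], [6,0,3,11,12,13,9,10], [1,3,8,9,14,17,4,6],
    [12,13,9,10,6,1,3,11], [12,15,17,10,6,0,3,11], [17,10,6,1,3,11,12,15],
    [13,15,17,10,6,7,11,8], [17,4,6,1,3,8,12,15], [4,6,0,3,8,12,15,17], [15,13,9,10,6,7,11,16],
    [4,6,1,3,8,9,14,15,16], [6,1,3,11,16,15,13,9,10], [6,0,3,8,9,14,15,16,4],
    [3,11,16,15,13,9,10,6,0]
  ]"

definition cycle_in :: "(nat \<times> nat) list \<Rightarrow> nat list \<Rightarrow> bool" where
  "cycle_in es c \<longleftrightarrow> 3 \<le> length c \<and> distinct c \<and>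
     list_all (\<lambda>(u, v). (u, v) \<in> set es \<or> (v, u) \<in> set es) (zip c (rotate1 c))"

lemma block_cycles: "list_all (cycle_in block_edges) block_cycles"
  by code_simp

lemma block_cycles_range: "list_all (list_all (\<lambda>x. x < 18 \<and> x \<noteq> 2)) block_cycles"
  by code_simp

text \<open>The fact about the block on which the construction rests: meeting all these cycles and
the distinguished edge takes 9 of the 17 vertices. The search has about 450 nodes.\<close>

lemma block_unhittable: "unhittable 8 ([1, 0] # block_cycles)"
  by code_simp

section \<open>Barycentric coordinates\<close>

lemma DIM_complex_2: "DIM(complex) = 2" by simp

definition bary :: "complex \<Rightarrow> complex \<Rightarrow> complex \<Rightarrow> real \<Rightarrow> real \<Rightarrow> real \<Rightarrow> complex" where
  "bary a b c p q r = p *\<^sub>R a + q *\<^sub>R b + r *\<^sub>R c"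

lemma bary_unique:
  assumes "\<not> collinear {a, b, c}" "bary a b c p q r = bary a b c p' q' r'"
    and "p + q + r = 1" "p' + q' + r' = 1"
  shows "p = p'" "q = q'" "r = r'"
proof -
  have nc: "\<not> collinear {0, b - a, c - a}"
    using assms(1) collinear_3[of b a c] by (auto simp: insert_commute collinear_3)
  have P: "p = 1 - q - r" "p' = 1 - q' - r'" using assms by auto
  have eq: "(q - q') *\<^sub>R (b - a) + (r - r') *\<^sub>R (c - a) = 0"
    using assms(2) unfolding bary_def P by (simp add: algebra_simps)
  have r: "r = r'"
  proof (rule ccontr)
    assume "r \<noteq> r'"
    then have "c - a = inverse (r - r') *\<^sub>R ((r - r') *\<^sub>R (c - a))" by simp
    also have "(r - r') *\<^sub>R (c - a) = - ((q - q') *\<^sub>R (b - a))"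
      using eq by (simp add: eq_neg_iff_add_eq_0 add.commute)
    finally have "c - a = (- inverse (r - r') * (q - q')) *\<^sub>R (b - a)" by simp
    then show False using nc collinear_lemma by blast
  qed
  have "b - a \<noteq> 0" using nc collinear_lemma by blast
  then show q: "q = q'" using eq r by simp
  show "r = r'" by fact
  show "p = p'" using P q r by simp
qed

lemma hull_bary:
  "y \<in> convex hull {a, b, c} \<longleftrightarrow>
     (\<exists>p q r. 0 \<le> p \<and> 0 \<le> q \<and> 0 \<le> r \<and> p + q + r = 1 \<and> y = bary a b c p q r)"
  unfolding convex_hull_3 bary_def by blast

lemma interior_bary:
  assumes "\<not> collinear {a, b, c}"
  shows "y \<in> interior (convex hull {a, b, c}) \<longleftrightarrow>
     (\<exists>p q r. 0 < p \<and> 0 < q \<and> 0 < r \<and> p + q + r = 1 \<and> y = bary a b c p q r)"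
    (is "?L \<longleftrightarrow> ?R")
proof
  assume L: ?L
  then have h: "y \<in> convex hull {a, b, c}" and n: "y \<notin> closed_segment a b"
    "y \<notin> closed_segment b c" "y \<notin> closed_segment c a"
    by (auto simp: interior_of_triangle[OF DIM_complex_2])
  obtain p q r where *: "0 \<le> p" "0 \<le> q" "0 \<le> r" "p + q + r = 1" "y = bary a b c p q r"
    using h unfolding hull_bary by blast
  have "p \<noteq> 0"
  proof
    assume "p = 0" then have "q = 1 - r" using * by simp
    then have "y = (1 - r) *\<^sub>R b + r *\<^sub>R c" using * \<open>p = 0\<close> by (simp add: bary_def)
    moreover have "r \<le> 1" using * by linarith
    ultimately show False using n(2) * in_segment by blast
  qed
  moreover have "q \<noteq> 0"
  proof
    assume "q = 0" then have "r = 1 - p" using * by simp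
    then have "y = (1 - p) *\<^sub>R c + p *\<^sub>R a" using * \<open>q = 0\<close> by (simp add: bary_def)
    moreover have "p \<le> 1" using * by linarith
    ultimately show False using n(3) * in_segment by blast
  qed
  moreover have "r \<noteq> 0"
  proof
    assume "r = 0" then have "p = 1 - q" using * by simp
    then have "y = (1 - q) *\<^sub>R a + q *\<^sub>R b" using * \<open>r = 0\<close> by (simp add: bary_def)
    moreover have "q \<le> 1" using * by linarith
    ultimately show False using n(1) * in_segment by blast
  qed
  ultimately show ?R using * by (metis less_eq_real_def)
next
  assume ?R
  then obtain p q r where *: "0 < p" "0 < q" "0 < r" "p + q + r = 1" "y = bary a b c p q r"
    by blast
  have h: "y \<in> convex hull {a, b, c}" unfolding hull_bary using * less_imp_le by blast
  have "y \<notin> closed_segment a b"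
  proof
    assume "y \<in> closed_segment a b"
    then obtain u where "y = bary a b c (1 - u) u 0" unfolding in_segment bary_def by auto
    then show False using bary_unique(3)[OF assms, of p q r "1 - u" u 0] * by auto
  qed
  moreover have "y \<notin> closed_segment b c"
  proof
    assume "y \<in> closed_segment b c"
    then obtain u where "y = bary a b c 0 (1 - u) u" unfolding in_segment bary_def by auto
    then show False using bary_unique(1)[OF assms, of p q r 0 "1 - u" u] * by auto
  qed
  moreover have "y \<notin> closed_segment c a"
  proof
    assume "y \<in> closed_segment c a"
    then obtain u where "y = bary a b c u 0 (1 - u)" unfolding in_segment bary_def
      by (auto simp: add.commute)
    then show False using bary_unique(2)[OF assms, of p q r u 0 "1 - u"] * by auto
  qed
  ultimately show ?L using h by (auto simp: interior_of_triangle[OF DIM_complex_2])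
qed

text \<open>The third coordinate measures the distance to the line \<open>ab\<close>; the coordinates
may be negative here, as they are for the far corner of a neighbouring face.\<close>

lemma not_collinear_bary:
  assumes "\<not> collinear {a, b, c}" "x = bary a b c p q r" "p + q + r = 1" "r \<noteq> 0"
  shows "\<not> collinear {a, b, x}"
proof
  assume "collinear {a, b, x}"
  moreover have "a \<noteq> b" using assms(1) by auto
  ultimately obtain u where u: "x = u *\<^sub>R a + (1 - u) *\<^sub>R b"
    using collinear_3_expand[of a x b] by (auto simp: insert_commute)
  then have "x = bary a b c u (1 - u) 0" by (simp add: bary_def)
  then show False using bary_unique(3)[OF assms(1), of p q r u "1 - u" 0] assms by simp
qed

subsection \<open>A point inside a triangle\<close>

text \<open>Everything is compared in coordinates with respect to the old triangle \<open>abc\<close>. Relative to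
the coordinates of \<open>x\<close>, the smallest coordinate of a point tells in which of the three new
triangles it lies.\<close>

context
  fixes a b c x :: complex and \<alpha> \<beta> \<gamma> :: real
  assumes nc: "\<not> collinear {a, b, c}"
    and pos: "0 < \<alpha>" "0 < \<beta>" "0 < \<gamma>" "\<alpha> + \<beta> + \<gamma> = 1" and x: "x = bary a b c \<alpha> \<beta> \<gamma>"
begin

lemma stack_nc: "\<not> collinear {a, b, x}"
  using not_collinear_bary[OF nc x] pos by simp

lemma stack_repr:
  "bary a b x p q r = bary a b c (p + r * \<alpha>) (q + r * \<beta>) (r * \<gamma>)"
  unfolding x bary_def by (simp add: algebra_simps)

lemma stack_scaled: "r * \<alpha> + r * \<beta> + r * \<gamma> = r"
proof -
  have "r * (\<alpha> + \<beta> + \<gamma>) = r" using pos(4) by simp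
  then show ?thesis unfolding distrib_left .
qed

lemma stack_sum: "p + q + r = 1 \<Longrightarrow> (p + r * \<alpha>) + (q + r * \<beta>) + (r * \<gamma>) = 1"
  using stack_scaled[of r] by linarith

lemma stack_seg: "closed_segment x a \<subseteq> insert a (interior (convex hull {a, b, c}))"
proof
  fix y assume "y \<in> closed_segment x a"
  then obtain u where u: "0 \<le> u" "u \<le> 1" "y = (1 - u) *\<^sub>R x + u *\<^sub>R a" unfolding in_segment by blast
  show "y \<in> insert a (interior (convex hull {a, b, c}))"
  proof (cases "u = 1")
    case False
    then have u1: "0 < 1 - u" using u by simp
    have "y = bary a b c (u + (1 - u) * \<alpha>) ((1 - u) * \<beta>) ((1 - u) * \<gamma>)"
      using u stack_repr[of u 0 "1 - u"] by (simp add: bary_def add.commute)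
    moreover have "u + (1 - u) * \<alpha> + (1 - u) * \<beta> + (1 - u) * \<gamma> = 1"
      using stack_sum[of u 0 "1 - u"] by simp
    ultimately show ?thesis unfolding insert_iff interior_bary[OF nc]
      using u1 u pos by (metis add_nonneg_pos mult_pos_pos)
  qed (use u in auto)
qed

lemma stack_interior: "interior (convex hull {a, b, x}) \<subseteq> interior (convex hull {a, b, c})"
proof
  fix y assume "y \<in> interior (convex hull {a, b, x})"
  then obtain p q r where *: "0 < p" "0 < q" "0 < r" "p + q + r = 1" "y = bary a b x p q r"
    unfolding interior_bary[OF stack_nc] by blast
  have "0 < p + r * \<alpha>" "0 < q + r * \<beta>" "0 < r * \<gamma>" using * pos by (auto intro: add_pos_pos)
  then show "y \<in> interior (convex hull {a, b, c})" unfolding interior_bary[OF nc]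
    using stack_repr[of p q r] stack_sum[OF *(4)] *(5) by blast
qed

lemma stack_interior_seg:
  "interior (convex hull {a, b, x}) \<inter> closed_segment x c = {}"
  "interior (convex hull {a, b, x}) \<inter> closed_segment x a = {}"
proof -
  { fix y and u :: real assume "y \<in> interior (convex hull {a, b, x})"
    then obtain p q r where *: "0 < p" "0 < q" "0 < r" "p + q + r = 1" "y = bary a b x p q r"
      unfolding interior_bary[OF stack_nc] by blast
    assume u: "0 \<le> u" "u \<le> 1"
    { assume "y = (1 - u) *\<^sub>R x + u *\<^sub>R a"
      then have "bary a b x p q r = bary a b x u 0 (1 - u)" using * by (simp add: bary_def add.commute)
      from bary_unique(2)[OF stack_nc this] have False using * by simp }
    moreover
    { assume "y = (1 - u) *\<^sub>R x + u *\<^sub>R c"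
      then have "y = bary a b c ((1 - u) * \<alpha>) ((1 - u) * \<beta>) ((1 - u) * \<gamma> + u)"
        unfolding x bary_def by (simp add: algebra_simps)
      then have e: "bary a b c (p + r * \<alpha>) (q + r * \<beta>) (r * \<gamma>) =
          bary a b c ((1 - u) * \<alpha>) ((1 - u) * \<beta>) ((1 - u) * \<gamma> + u)"
        using * stack_repr by simp
      have s: "(1 - u) * \<alpha> + (1 - u) * \<beta> + ((1 - u) * \<gamma> + u) = 1"
        using pos(4) stack_scaled[of "1 - u"] by linarith
      have e1: "p + r * \<alpha> = (1 - u) * \<alpha>" and e3: "r * \<gamma> = (1 - u) * \<gamma> + u"
        using bary_unique[OF nc e stack_sum[OF *(4)] s] by auto
      have "r * \<alpha> < (1 - u) * \<alpha>" using e1 * by linarith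
      then have "r < 1 - u" using pos by (simp add: mult_less_cancel_right_pos)
      moreover have "(1 - u) * \<gamma> \<le> r * \<gamma>" using e3 u by linarith
      then have "1 - u \<le> r" using pos by (simp add: mult_le_cancel_right_pos)
      ultimately have False by simp }
    ultimately have "y \<noteq> (1 - u) *\<^sub>R x + u *\<^sub>R c" "y \<noteq> (1 - u) *\<^sub>R x + u *\<^sub>R a" by blast+ }
  then show "interior (convex hull {a, b, x}) \<inter> closed_segment x c = {}"
    "interior (convex hull {a, b, x}) \<inter> closed_segment x a = {}"
    unfolding in_segment disjoint_iff by blast+
qed

lemma stack_seg_seg: "closed_segment x a \<inter> closed_segment x b = {x}"
proof -
  { fix y assume "y \<in> closed_segment x a" "y \<in> closed_segment x b"
    then obtain u v where "y = (1 - u) *\<^sub>R x + u *\<^sub>R a" "y = (1 - v) *\<^sub>R x + v *\<^sub>R b"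
      unfolding in_segment by blast
    then have "bary a b x u 0 (1 - u) = bary a b x 0 v (1 - v)" "y = bary a b x u 0 (1 - u)"
      by (auto simp: bary_def add.commute)
    then have "y = x" using bary_unique(1)[OF stack_nc, of u 0 "1 - u" 0 v "1 - v"] by (simp add: bary_def) }
  then show ?thesis by auto
qed

end

lemma stack_interiors_disjoint:
  assumes nc: "\<not> collinear {a, b, c}"
    and pos: "0 < \<alpha>" "0 < \<beta>" "0 < \<gamma>" "\<alpha> + \<beta> + \<gamma> = 1" and x: "x = bary a b c \<alpha> \<beta> \<gamma>"
  shows "interior (convex hull {a, b, x}) \<inter> interior (convex hull {b, c, x}) = {}"
proof -
  have nc': "\<not> collinear {b, c, a}" using nc by (simp add: insert_commute)
  have x': "x = bary b c a \<beta> \<gamma> \<alpha>" using x by (simp add: bary_def)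
  have pos': "\<beta> + \<gamma> + \<alpha> = 1" using pos by simp
  { fix y assume "y \<in> interior (convex hull {a, b, x})" "y \<in> interior (convex hull {b, c, x})"
    then obtain p q r p' q' r' where *: "0 < p" "0 < q" "0 < r" "p + q + r = 1" "y = bary a b x p q r"
      "0 < p'" "0 < q'" "0 < r'" "p' + q' + r' = 1" "y = bary b c x p' q' r'"
      unfolding interior_bary[OF stack_nc[OF nc pos x]]
        interior_bary[OF stack_nc[OF nc' pos(2,3,1) pos' x']] by blast
    have "bary a b c (p + r * \<alpha>) (q + r * \<beta>) (r * \<gamma>) = bary a b c (r' * \<alpha>) (p' + r' * \<beta>) (q' + r' * \<gamma>)"
      using *(5,10) unfolding x bary_def by (simp add: algebra_simps)
    moreover have "(p + r * \<alpha>) + (q + r * \<beta>) + (r * \<gamma>) = 1" 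
      by (rule stack_sum[OF nc pos x *(4)])
    moreover have "(r' * \<alpha>) + (p' + r' * \<beta>) + (q' + r' * \<gamma>) = 1"
      using stack_sum[OF nc' pos(2,3,1) pos' x' *(9)] by simp
    ultimately have e: "p + r * \<alpha> = r' * \<alpha>" "r * \<gamma> = q' + r' * \<gamma>"
      using bary_unique[OF nc] by blast+
    have "r * \<alpha> < r' * \<alpha>" "r' * \<gamma> < r * \<gamma>" using e * by linarith+
    then have False using pos by (simp add: mult_less_cancel_right_pos) }
  then show ?thesis by blast
qed

lemma stack_hull:
  assumes pos: "0 < \<alpha>" "0 < \<beta>" "0 < \<gamma>" "\<alpha> + \<beta> + \<gamma> = 1" and x: "x = bary a b c \<alpha> \<beta> \<gamma>"
  shows "convex hull {a, b, c} = convex hull {a, b, x} \<union> convex hull {b, c, x} \<union> convex hull {a, c, x}"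
proof -
  have xin: "x \<in> convex hull {a, b, c}" unfolding hull_bary using pos x less_imp_le by blast
  have sub: "convex hull S \<subseteq> convex hull {a, b, c}" if "S \<subseteq> {a, b, c, x}" for S
    by (rule hull_minimal) (use that xin in \<open>auto intro: hull_inc\<close>)
  have "convex hull {a, b, c} = convex hull (insert x ({a, b, c} - {a})) \<union>
      (convex hull (insert x ({a, b, c} - {b})) \<union> convex hull (insert x ({a, b, c} - {c})))"
    using convex_hull_exchange_Union[OF xin] unfolding UN_insert UN_empty Un_empty_right .
  moreover have "convex hull (insert x ({a, b, c} - {a})) \<subseteq> convex hull {b, c, x}"
    "convex hull (insert x ({a, b, c} - {b})) \<subseteq> convex hull {a, c, x}"
    "convex hull (insert x ({a, b, c} - {c})) \<subseteq> convex hull {a, b, x}"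
    by (rule hull_mono; blast)+
  ultimately have "convex hull {a, b, c} \<subseteq>
      convex hull {a, b, x} \<union> convex hull {b, c, x} \<union> convex hull {a, c, x}" by blast
  then show ?thesis using sub[of "{a, b, x}"] sub[of "{b, c, x}"] sub[of "{a, c, x}"] by blast
qed


subsection \<open>Exchanging a diagonal\<close>

text \<open>If the segments \<open>bc\<close> and \<open>ad\<close> cross, then \<open>d\<close> has one negative and two positive
coordinates with respect to \<open>abc\<close>.\<close>

lemma flip_repr:
  assumes "0 < s" "s < 1" "0 < t" "t < (1::real)"
    and "(1 - s) *\<^sub>R b + s *\<^sub>R c = (1 - t) *\<^sub>R a + t *\<^sub>R (d::complex)"
  shows "d = bary a b c (- ((1 - t) / t)) ((1 - s) / t) (s / t)"
    "- ((1 - t) / t) + (1 - s) / t + s / t = 1"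
proof -
  have "t *\<^sub>R d = (1 - s) *\<^sub>R b + s *\<^sub>R c - (1 - t) *\<^sub>R a" using assms(5) by (simp add: algebra_simps)
  then have "inverse t *\<^sub>R (t *\<^sub>R d) = inverse t *\<^sub>R ((1 - s) *\<^sub>R b + s *\<^sub>R c - (1 - t) *\<^sub>R a)" by simp
  then show "d = bary a b c (- ((1 - t) / t)) ((1 - s) / t) (s / t)"
    using assms(3) by (simp add: bary_def scaleR_diff_right scaleR_add_right divide_inverse mult.commute)
  show "- ((1 - t) / t) + (1 - s) / t + s / t = 1" using assms(3) by (simp add: field_simps)
qed

context
  fixes a b c d :: complex and \<kappa> \<eta> \<mu> :: real
  assumes nc: "\<not> collinear {a, b, c}"
    and pos: "0 < \<kappa>" "0 < \<eta>" "0 < \<mu>" "- \<kappa> + \<eta> + \<mu> = 1" and d: "d = bary a b c (- \<kappa>) \<eta> \<mu>"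
begin

lemma flip_nc: "\<not> collinear {a, b, d}"
  using not_collinear_bary[OF nc d] pos by simp

lemma flip_nc': "\<not> collinear {d, b, c}"
proof -
  have nc': "\<not> collinear {b, c, a}" using nc by (simp add: insert_commute)
  have "d = bary b c a \<eta> \<mu> (- \<kappa>)" using d by (simp add: bary_def)
  from not_collinear_bary[OF nc' this] show ?thesis using pos by (simp add: insert_commute)
qed

lemma flip_repr_new:
  "bary a b d p q r = bary a b c (p - r * \<kappa>) (q + r * \<eta>) (r * \<mu>)"
  unfolding d bary_def by (simp add: algebra_simps)

lemma flip_repr_old:
  "bary d b c p q r = bary a b c (- (p * \<kappa>)) (q + p * \<eta>) (r + p * \<mu>)"
  unfolding d bary_def by (simp add: algebra_simps)

lemma flip_scaled: "- (r * \<kappa>) + r * \<eta> + r * \<mu> = r"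
proof -
  have "r * (- \<kappa> + \<eta> + \<mu>) = r" using pos(4) by simp
  then show ?thesis unfolding distrib_left mult_minus_right .
qed

text \<open>The sign of the first coordinate with respect to \<open>abc\<close> decides on which side of the old
diagonal \<open>bc\<close> a point of the new triangle lies. The new triangle and the new diagonal are thus
covered by two old faces and the removed edge, and can only meet what these meet.\<close>

lemma flip_cases:
  assumes "0 \<le> p" "0 \<le> q" "0 < r" "p + q + r = 1" "0 < p \<or> 0 < q"
  shows "bary a b d p q r \<in> interior (convex hull {a, b, c}) \<union> interior (convex hull {d, b, c})
    \<union> open_segment b c \<or> p = 0"
proof -
  let ?p = "p - r * \<kappa>" and ?q = "q + r * \<eta>" and ?r = "r * \<mu>"
  have sum: "?p + ?q + ?r = 1" using flip_scaled[of r] assms by linarith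
  have q: "0 < ?q" and r: "0 < ?r" using assms pos by (auto intro: add_nonneg_pos)
  consider "0 < ?p" | "?p = 0" | "?p < 0" by linarith
  then show ?thesis
  proof cases
    case 1
    then show ?thesis using q r sum flip_repr_new interior_bary[OF nc] by blast
  next
    case 2
    then have "?q = 1 - ?r" using sum by linarith
    then have "bary a b d p q r = (1 - ?r) *\<^sub>R b + ?r *\<^sub>R c"
      using flip_repr_new[of p q r] 2 by (simp add: bary_def)
    moreover have "?r < 1" using 2 q sum by linarith
    moreover have "b \<noteq> c" using nc by auto
    ultimately show ?thesis using r unfolding in_segment Un_iff by blast
  next
    case 3
    show ?thesis
    proof (cases "p = 0")
      case False
      \<comment> \<open>chosen so that the coordinate of \<open>a\<close> vanishes after rewriting in terms of \<open>d\<close>, \<open>b\<close>, \<open>c\<close>\<close>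
      define z where "z = r - p / \<kappa>"
      have z\<kappa>: "z * \<kappa> = r * \<kappa> - p" using pos by (simp add: z_def field_simps)
      have "0 < z * \<kappa>" using 3 z\<kappa> by simp
      then have z: "0 < z" using pos zero_less_mult_pos2 by blast
      have zr: "r - z = p / \<kappa>" by (simp add: z_def)
      have l: "r * \<eta> - z * \<eta> = p / \<kappa> * \<eta>" "r * \<mu> - z * \<mu> = p / \<kappa> * \<mu>"
        using zr by (metis left_diff_distrib)+
      have "0 < p / \<kappa> * \<eta>" "0 < p / \<kappa> * \<mu>" using False assms pos by auto
      then have "0 < ?q - z * \<eta>" "0 < ?r - z * \<mu>" using l assms by linarith+
      moreover have "bary a b d p q r = bary d b c z (?q - z * \<eta>) (?r - z * \<mu>)"
        using z\<kappa> by (simp add: flip_repr_new flip_repr_old)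
      moreover have "z + (?q - z * \<eta>) + (?r - z * \<mu>) = 1"
        using sum flip_scaled[of z] z\<kappa> by linarith
      ultimately show ?thesis using z interior_bary[OF flip_nc'] by blast
    qed simp
  qed
qed

lemma flip_interior:
  "interior (convex hull {a, b, d}) \<subseteq>
     interior (convex hull {a, b, c}) \<union> interior (convex hull {d, b, c}) \<union> open_segment b c"
proof
  fix y assume "y \<in> interior (convex hull {a, b, d})"
  then obtain p q r where "0 < p" "0 < q" "0 < r" "p + q + r = 1" "y = bary a b d p q r"
    unfolding interior_bary[OF flip_nc] by blast
  then show "y \<in> interior (convex hull {a, b, c}) \<union> interior (convex hull {d, b, c}) \<union> open_segment b c"
    using flip_cases[of p q r] by auto
qed

lemma flip_seg:
  "closed_segment a d \<subseteq> insert a (insert d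
     (interior (convex hull {a, b, c}) \<union> interior (convex hull {d, b, c}) \<union> open_segment b c))"
proof
  fix y assume "y \<in> closed_segment a d"
  then obtain u where u: "0 \<le> u" "u \<le> 1" "y = (1 - u) *\<^sub>R a + u *\<^sub>R d" unfolding in_segment by blast
  show "y \<in> insert a (insert d
     (interior (convex hull {a, b, c}) \<union> interior (convex hull {d, b, c}) \<union> open_segment b c))"
  proof (cases "u = 0 \<or> u = 1")
    case False
    then have "0 < 1 - u" "0 < u" using u by auto
    moreover have "y = bary a b d (1 - u) 0 u" using u by (simp add: bary_def)
    ultimately show ?thesis using flip_cases[of "1 - u" 0 u] by auto
  qed (use u in auto)
qed

lemma flip_interior_seg: "interior (convex hull {a, b, d}) \<inter> closed_segment a d = {}"
proof -
  { fix y assume "y \<in> interior (convex hull {a, b, d})" "y \<in> closed_segment a d"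
    then obtain p q r u where *: "0 < p" "0 < q" "0 < r" "p + q + r = 1" "y = bary a b d p q r"
      "y = bary a b d (1 - u) 0 u"
      unfolding interior_bary[OF flip_nc] in_segment bary_def by auto
    then have False using bary_unique(2)[OF flip_nc, of p q r "1 - u" 0 u] by simp }
  then show ?thesis by blast
qed

end

lemma flip_interiors_disjoint:
  assumes nc: "\<not> collinear {a, b, c}"
    and pos: "0 < \<kappa>" "0 < \<eta>" "0 < \<mu>" "- \<kappa> + \<eta> + \<mu> = 1" and d: "d = bary a b c (- \<kappa>) \<eta> \<mu>"
  shows "interior (convex hull {a, b, d}) \<inter> interior (convex hull {a, c, d}) = {}"
proof -
  have nc': "\<not> collinear {a, c, b}" using nc by (simp add: insert_commute)
  have d': "d = bary a c b (- \<kappa>) \<mu> \<eta>" using d by (simp add: bary_def)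
  have pos': "- \<kappa> + \<mu> + \<eta> = 1" using pos by simp
  { fix y assume "y \<in> interior (convex hull {a, b, d})" "y \<in> interior (convex hull {a, c, d})"
    then obtain p q r p' q' r' where *: "0 < p" "0 < q" "0 < r" "p + q + r = 1" "y = bary a b d p q r"
      "0 < p'" "0 < q'" "0 < r'" "p' + q' + r' = 1" "y = bary a c d p' q' r'"
      unfolding interior_bary[OF flip_nc[OF nc pos d]]
        interior_bary[OF flip_nc[OF nc' pos(1,3,2) pos' d']] by blast
    have "bary a b c (p - r * \<kappa>) (q + r * \<eta>) (r * \<mu>) = bary a b c (p' - r' * \<kappa>) (r' * \<eta>) (q' + r' * \<mu>)"
      using *(5,10) unfolding d bary_def by (simp add: algebra_simps)
    moreover have "(p - r * \<kappa>) + (q + r * \<eta>) + (r * \<mu>) = 1"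
      using flip_scaled[OF nc pos d, of r] *(4) by linarith
    moreover have "(p' - r' * \<kappa>) + (r' * \<eta>) + (q' + r' * \<mu>) = 1"
      using flip_scaled[OF nc pos d, of r'] *(9) by linarith
    ultimately have e: "q + r * \<eta> = r' * \<eta>" "r * \<mu> = q' + r' * \<mu>"
      using bary_unique[OF nc] by blast+
    have "r * \<eta> < r' * \<eta>" "r' * \<mu> < r * \<mu>" using e * by linarith+
    then have False using pos by (simp add: mult_less_cancel_right_pos) }
  then show ?thesis by blast
qed

text \<open>The crossing point \<open>P\<close> cuts \<open>abc\<close> into two triangles, one in each of the new faces. The
roles of the two diagonals are symmetric, so one inclusion, applied four times, is enough.\<close>

lemma flip_hull:
  assumes "(1 - s) *\<^sub>R b + s *\<^sub>R c = (1 - t) *\<^sub>R a + t *\<^sub>R (d::complex)"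
    and "0 < s" "s < 1" "0 < t" "t < 1"
  shows "convex hull {a, b, c} \<union> convex hull {d, b, c} = convex hull {a, b, d} \<union> convex hull {a, c, d}"
proof -
  have main: "convex hull {a, b, c} \<subseteq> convex hull {a, b, d} \<union> convex hull {a, c, d}"
    if "(1 - s) *\<^sub>R b + s *\<^sub>R c = (1 - t) *\<^sub>R a + t *\<^sub>R d" "0 < s" "s < 1" "0 < t" "t < 1"
    for a b c d :: complex and s t :: real
  proof -
    define P where "P = (1 - s) *\<^sub>R b + s *\<^sub>R c"
    have Pbc: "P \<in> convex hull {b, c}" unfolding P_def segment_convex_hull[symmetric] in_segment
      using that less_imp_le by blast
    have Pad: "P \<in> convex hull {a, d}" unfolding P_def that(1) segment_convex_hull[symmetric] in_segment
      using that less_imp_le by blast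
    have "P \<in> convex hull {a, b, c}" using Pbc hull_mono[of "{b, c}" "{a, b, c}"] by blast
    from convex_hull_exchange_Union[OF this]
    have "convex hull {a, b, c} = convex hull (insert P ({a, b, c} - {a})) \<union>
        (convex hull (insert P ({a, b, c} - {b})) \<union> convex hull (insert P ({a, b, c} - {c})))"
      unfolding UN_insert UN_empty Un_empty_right .
    moreover have "convex hull (insert P ({a, b, c} - {a})) \<subseteq> convex hull {a, b, d} \<union> convex hull {a, c, d}"
    proof -
      have "convex hull (insert P ({a, b, c} - {a})) \<subseteq> convex hull {b, c}"
        by (rule hull_minimal) (use Pbc in \<open>auto intro: hull_inc\<close>)
      also have "\<dots> = closed_segment b P \<union> closed_segment P c"
        using Pbc by (simp add: segment_convex_hull[symmetric] Un_closed_segment)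
      also have "closed_segment b P \<subseteq> convex hull {a, b, d}"
        unfolding segment_convex_hull using Pad hull_mono[of "{a, d}" "{a, b, d}"]
        by (intro hull_minimal) (auto intro: hull_inc)
      also have "closed_segment P c \<subseteq> convex hull {a, c, d}"
        unfolding segment_convex_hull using Pad hull_mono[of "{a, d}" "{a, c, d}"]
        by (intro hull_minimal) (auto intro: hull_inc)
      finally show ?thesis by blast
    qed
    moreover have "convex hull (insert P ({a, b, c} - {b})) \<subseteq> convex hull {a, c, d}"
      using Pad hull_mono[of "{a, d}" "{a, c, d}"] by (intro hull_minimal) (auto intro: hull_inc)
    moreover have "convex hull (insert P ({a, b, c} - {c})) \<subseteq> convex hull {a, b, d}"
      using Pad hull_mono[of "{a, d}" "{a, b, d}"] by (intro hull_minimal) (auto intro: hull_inc)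
    ultimately show ?thesis by blast
  qed
  have 2: "(1 - (1 - t)) *\<^sub>R d + (1 - t) *\<^sub>R a = (1 - s) *\<^sub>R b + s *\<^sub>R c"
    "(1 - t) *\<^sub>R a + t *\<^sub>R d = (1 - s) *\<^sub>R b + s *\<^sub>R c"
    "(1 - s) *\<^sub>R b + s *\<^sub>R c = (1 - (1 - t)) *\<^sub>R d + (1 - t) *\<^sub>R a"
    "(1 - t) *\<^sub>R a + t *\<^sub>R d = (1 - (1 - s)) *\<^sub>R c + (1 - s) *\<^sub>R b"
    using assms(1) by (simp_all add: add.commute)
  show ?thesis
  proof (rule equalityI)
    have "convex hull {d, b, c} \<subseteq> convex hull {d, b, a} \<union> convex hull {d, c, a}"
      by (rule main[OF 2(3)]) (use assms in auto)
    then show "convex hull {a, b, c} \<union> convex hull {d, b, c} \<subseteq> convex hull {a, b, d} \<union> convex hull {a, c, d}"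
      using main[OF assms] unfolding insert_commute[of d b "{a}"] insert_commute[of d c "{a}"]
        insert_commute[of d a "{}"] insert_commute[of b a "{d}"] insert_commute[of c a "{d}"] by blast
    have "convex hull {b, a, d} \<subseteq> convex hull {b, a, c} \<union> convex hull {b, d, c}"
      by (rule main[OF 2(2)]) (use assms in auto)
    moreover have "convex hull {c, a, d} \<subseteq> convex hull {c, a, b} \<union> convex hull {c, d, b}"
      by (rule main[OF 2(4)]) (use assms in auto)
    moreover have "{b, a, d} = {a, b, d}" "{b, a, c} = {a, b, c}" "{b, d, c} = {d, b, c}"
      "{c, a, d} = {a, c, d}" "{c, a, b} = {a, b, c}" "{c, d, b} = {d, b, c}" by auto
    ultimately show "convex hull {a, b, d} \<union> convex hull {a, c, d} \<subseteq> convex hull {a, b, c} \<union> convex hull {d, b, c}"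
      by simp
  qed
qed

text \<open>The hypotheses of this lemma and the next are symmetric in the corners, so that
permuted instances are available without recomputing coordinates.\<close>

lemma stack_facts:
  fixes a b c x :: complex
  assumes nc: "\<not> collinear {a, b, c}" and x: "x \<in> interior (convex hull {a, b, c})"
  shows "\<not> collinear {a, b, x}"
    "closed_segment x a \<subseteq> insert a (interior (convex hull {a, b, c}))"
    "closed_segment x a \<inter> closed_segment x b = {x}"
    "interior (convex hull {a, b, x}) \<subseteq> interior (convex hull {a, b, c})"
    "interior (convex hull {a, b, x}) \<inter> closed_segment x c = {}"
    "interior (convex hull {a, b, x}) \<inter> closed_segment x a = {}"
    "interior (convex hull {a, b, x}) \<inter> interior (convex hull {b, c, x}) = {}"
    "convex hull {a, b, c} = convex hull {a, b, x} \<union> convex hull {b, c, x} \<union> convex hull {a, c, x}"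
proof -
  obtain \<alpha> \<beta> \<gamma> where p: "0 < \<alpha>" "0 < \<beta>" "0 < \<gamma>" "\<alpha> + \<beta> + \<gamma> = 1" and x: "x = bary a b c \<alpha> \<beta> \<gamma>"
    using x unfolding interior_bary[OF nc] by blast
  note q = nc p x
  show "\<not> collinear {a, b, x}" by (rule stack_nc[OF q])
  show "closed_segment x a \<subseteq> insert a (interior (convex hull {a, b, c}))" by (rule stack_seg[OF q])
  show "closed_segment x a \<inter> closed_segment x b = {x}" by (rule stack_seg_seg[OF q])
  show "interior (convex hull {a, b, x}) \<subseteq> interior (convex hull {a, b, c})" by (rule stack_interior[OF q])
  show "interior (convex hull {a, b, x}) \<inter> closed_segment x c = {}"
    "interior (convex hull {a, b, x}) \<inter> closed_segment x a = {}" by (rule stack_interior_seg[OF q])+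
  show "interior (convex hull {a, b, x}) \<inter> interior (convex hull {b, c, x}) = {}"
    by (rule stack_interiors_disjoint[OF q])
  show "convex hull {a, b, c} = convex hull {a, b, x} \<union> convex hull {b, c, x} \<union> convex hull {a, c, x}"
    by (rule stack_hull[OF p x])
qed

lemma flip_facts:
  fixes a b c d P :: complex
  assumes nc: "\<not> collinear {a, b, c}" and P: "P \<in> open_segment b c" "P \<in> open_segment a d"
  shows "\<not> collinear {a, b, d}"
    "interior (convex hull {a, b, d}) \<subseteq>
     interior (convex hull {a, b, c}) \<union> interior (convex hull {d, b, c}) \<union> open_segment b c"
    "closed_segment a d \<subseteq> insert a (insert d
     (interior (convex hull {a, b, c}) \<union> interior (convex hull {d, b, c}) \<union> open_segment b c))"
    "interior (convex hull {a, b, d}) \<inter> closed_segment a d = {}"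
    "interior (convex hull {a, b, d}) \<inter> interior (convex hull {a, c, d}) = {}"
    "convex hull {a, b, c} \<union> convex hull {d, b, c} = convex hull {a, b, d} \<union> convex hull {a, c, d}"
proof -
  obtain s where s: "0 < s" "s < 1" "P = (1 - s) *\<^sub>R b + s *\<^sub>R c" using P(1) unfolding in_segment by blast
  obtain t where t: "0 < t" "t < 1" "P = (1 - t) *\<^sub>R a + t *\<^sub>R d" using P(2) unfolding in_segment by blast
  have eq: "(1 - s) *\<^sub>R b + s *\<^sub>R c = (1 - t) *\<^sub>R a + t *\<^sub>R d" using s(3) t(3) by simp
  note f = flip_repr[OF s(1,2) t(1,2) eq]
  have p: "0 < (1 - t) / t" "0 < (1 - s) / t" "0 < s / t" using s t by auto
  note q = nc p f(2) f(1)
  show "\<not> collinear {a, b, d}" by (rule flip_nc[OF q])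
  show "interior (convex hull {a, b, d}) \<subseteq>
     interior (convex hull {a, b, c}) \<union> interior (convex hull {d, b, c}) \<union> open_segment b c"
    by (rule flip_interior[OF q])
  show "closed_segment a d \<subseteq> insert a (insert d
     (interior (convex hull {a, b, c}) \<union> interior (convex hull {d, b, c}) \<union> open_segment b c))"
    by (rule flip_seg[OF q])
  show "interior (convex hull {a, b, d}) \<inter> closed_segment a d = {}" by (rule flip_interior_seg[OF q])
  show "interior (convex hull {a, b, d}) \<inter> interior (convex hull {a, c, d}) = {}"
    by (rule flip_interiors_disjoint[OF q])
  show "convex hull {a, b, c} \<union> convex hull {d, b, c} = convex hull {a, b, d} \<union> convex hull {a, c, d}"
    by (rule flip_hull[OF eq s(1,2) t(1,2)])
qed

section \<open>Straight-line triangulations of a triangle\<close>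

definition hull_of :: "('a \<Rightarrow> complex) \<Rightarrow> 'a set \<Rightarrow> complex set" where
  "hull_of pos s = convex hull (pos ` s)"

lemma hull_of_2 [simp]: "hull_of pos {u, v} = closed_segment (pos u) (pos v)"
  by (simp add: hull_of_def segment_convex_hull)

lemma hull_of_3 [simp]: "hull_of pos {u, v, w} = convex hull {pos u, pos v, pos w}"
  by (simp add: hull_of_def)

text \<open>The faces \<open>T\<close> are the bounded ones; \<open>R\<close> is the boundary of the unbounded face. A new edge
drawn inside some faces must not enter another face, which is why \<open>face_disj\<close> is part of the
invariant; \<open>cover\<close> ensures that no bounded face is missing from the list.\<close>

locale triangulated =
  fixes pos :: "'a \<Rightarrow> complex" and V :: "'a set" and E T :: "'a set set" and R :: "'a set"
  assumes finite_V: "finite V" and inj: "inj_on pos V"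
    and edge: "e \<in> E \<Longrightarrow> e \<subseteq> V \<and> card e = 2"
    and edge_inter: "e \<in> E \<Longrightarrow> e' \<in> E \<Longrightarrow> e \<noteq> e' \<Longrightarrow> hull_of pos e \<inter> hull_of pos e' \<subseteq> pos ` (e \<inter> e')"
    and edge_vert: "e \<in> E \<Longrightarrow> v \<in> V \<Longrightarrow> pos v \<in> hull_of pos e \<Longrightarrow> v \<in> e"
    and face: "t \<in> T \<Longrightarrow> card t = 3 \<and> \<not> collinear (pos ` t) \<and> (\<forall>u\<in>t. \<forall>v\<in>t. u \<noteq> v \<longrightarrow> {u, v} \<in> E)"
    and face_edge: "t \<in> T \<Longrightarrow> e \<in> E \<Longrightarrow> interior (hull_of pos t) \<inter> hull_of pos e = {}"
    and face_vert: "t \<in> T \<Longrightarrow> v \<in> V \<Longrightarrow> pos v \<notin> interior (hull_of pos t)"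
    and face_disj: "t \<in> T \<Longrightarrow> t' \<in> T \<Longrightarrow> t \<noteq> t' \<Longrightarrow>
      interior (hull_of pos t) \<inter> interior (hull_of pos t') = {}"
    and rim: "card R = 3" "\<not> collinear (pos ` R)" "u \<in> R \<Longrightarrow> v \<in> R \<Longrightarrow> u \<noteq> v \<Longrightarrow> {u, v} \<in> E"
    and cover: "hull_of pos R = (\<Union>t\<in>T. hull_of pos t)"
    and inside: "v \<in> V \<Longrightarrow> pos v \<in> hull_of pos R"
begin

lemma face_props:
  assumes "{a, b, c} \<in> T"
  shows "\<not> collinear {pos a, pos b, pos c}" "a \<noteq> b" "b \<noteq> c" "a \<noteq> c"
    "{a, b} \<in> E" "{b, c} \<in> E" "{a, c} \<in> E" "a \<in> V" "b \<in> V" "c \<in> V"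
proof -
  have c3: "card {a, b, c} = 3" and nc: "\<not> collinear {pos a, pos b, pos c}"
    using face[OF assms] by auto
  have d: "a \<noteq> b" "b \<noteq> c" "a \<noteq> c" using c3 by (auto simp: card_insert_if split: if_splits)
  then show e: "{a, b} \<in> E" "{b, c} \<in> E" "{a, c} \<in> E" using face[OF assms] by auto
  show "a \<in> V" "b \<in> V" "c \<in> V" using edge e by blast+
  show "\<not> collinear {pos a, pos b, pos c}" "a \<noteq> b" "b \<noteq> c" "a \<noteq> c" by fact+
qed

lemma vert_hull: "v \<in> e \<Longrightarrow> pos v \<in> hull_of pos e"
  by (simp add: hull_of_def hull_inc)

end

lemma card_3I: "a \<noteq> b \<Longrightarrow> b \<noteq> c \<Longrightarrow> a \<noteq> c \<Longrightarrow> card {a, b, c} = 3"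
  by simp

lemma (in triangulated) stack:
  assumes t: "{a, b, c} \<in> T" and x: "x \<notin> V" and px: "pos x \<in> interior (hull_of pos {a, b, c})"
  shows "triangulated pos (insert x V) (E \<union> {{x, a}, {x, b}, {x, c}})
    (T - {{a, b, c}} \<union> {{a, b, x}, {b, c, x}, {a, c, x}}) R"
proof -
  define I where "I = interior (hull_of pos {a, b, c})"
  define N where "N = {{x, a}, {x, b}, {x, c}}"
  define F where "F = {{a, b, x}, {b, c, x}, {a, c, x}}"
  note fp = face_props[OF t]
  note nc = fp(1)
  have xn: "x \<noteq> a" "x \<noteq> b" "x \<noteq> c" using x fp by auto
  have px': "pos x \<in> interior (convex hull {pos a, pos b, pos c})" using px by simp
  have nc2: "\<not> collinear {pos b, pos c, pos a}" "\<not> collinear {pos a, pos c, pos b}"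
     "\<not> collinear {pos b, pos a, pos c}" "\<not> collinear {pos c, pos a, pos b}" "\<not> collinear {pos c, pos b, pos a}"
    using nc by (simp_all add: insert_commute)
  have px2: "pos x \<in> interior (convex hull {pos b, pos c, pos a})" "pos x \<in> interior (convex hull {pos a, pos c, pos b})"
     "pos x \<in> interior (convex hull {pos b, pos a, pos c})" "pos x \<in> interior (convex hull {pos c, pos a, pos b})"
     "pos x \<in> interior (convex hull {pos c, pos b, pos a})"
    using px' by (simp_all add: insert_commute)
  note sf = stack_facts(1-7)[OF nc px'] stack_facts(1-7)[OF nc2(1) px2(1)] stack_facts(1-7)[OF nc2(2) px2(2)]
    stack_facts(1-7)[OF nc2(3) px2(3)] stack_facts(1-7)[OF nc2(4) px2(4)] stack_facts(1-7)[OF nc2(5) px2(5)]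
  have hI: "I = interior (convex hull {pos a, pos b, pos c})" by (simp add: I_def)
  have perm: "{pos b, pos c, pos a} = {pos a, pos b, pos c}" "{pos a, pos c, pos b} = {pos a, pos b, pos c}"
    "{pos b, pos a, pos c} = {pos a, pos b, pos c}" "{pos c, pos a, pos b} = {pos a, pos b, pos c}"
    "{pos c, pos b, pos a} = {pos a, pos b, pos c}"
    "{pos b, pos a, pos x} = {pos a, pos b, pos x}" "{pos c, pos b, pos x} = {pos b, pos c, pos x}"
    "{pos c, pos a, pos x} = {pos a, pos c, pos x}" by auto
  note sf' = sf[unfolded perm, folded hI]
  have segN: "hull_of pos {x, v} \<subseteq> insert (pos v) I" if "v \<in> {a, b, c}" for v
    using that sf' by auto
  have intF: "interior (hull_of pos f) \<subseteq> I" if "f \<in> F" for f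
    using that sf' by (auto simp: F_def)
  have FN: "interior (hull_of pos f) \<inter> hull_of pos e = {}" if "f \<in> F" "e \<in> N" for f e
    using that unfolding F_def N_def by (elim insertE emptyE) (simp_all add: sf')
  have FF: "interior (hull_of pos f) \<inter> interior (hull_of pos g) = {}" if "f \<in> F" "g \<in> F" "f \<noteq> g" for f g
    using that unfolding F_def by (elim insertE emptyE) (simp_all add: sf' Int_commute)
  have NN: "hull_of pos {x, v} \<inter> hull_of pos {x, w} \<subseteq> {pos x}" if "v \<in> {a, b, c}" "w \<in> {a, b, c}" "v \<noteq> w" for v w
    using that by (elim insertE emptyE) (simp_all add: sf')
  have oldI: "I \<inter> hull_of pos e = {}" if "e \<in> E" for e using face_edge[OF t that] by (simp add: I_def)
  have VI: "pos v \<notin> I" if "v \<in> V" for v using face_vert[OF t that] by (simp add: I_def)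
  have TI: "interior (hull_of pos f) \<inter> I = {}" if "f \<in> T - {{a, b, c}}" for f
    using face_disj[OF _ t, of f] that by (auto simp: I_def)
  have NE: "hull_of pos e \<inter> hull_of pos e' \<subseteq> pos ` (e \<inter> e')" if eN: "e \<in> N" and eE: "e' \<in> E" for e e'
  proof
    fix y assume y: "y \<in> hull_of pos e \<inter> hull_of pos e'"
    obtain v where v: "v \<in> {a, b, c}" "e = {x, v}" using eN unfolding N_def by auto
    have "y \<notin> I" using oldI[OF eE] y by blast
    then have "y = pos v" using segN[OF v(1)] y v by blast
    then have "v \<in> e'" using edge_vert[OF eE, of v] y v fp by auto
    then show "y \<in> pos ` (e \<inter> e')" using v \<open>y = pos v\<close> by auto
  qed
  have xI: "pos x \<in> I" using px by (simp add: I_def)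
  show ?thesis unfolding N_def[symmetric] F_def[symmetric]
  proof
    show "finite (insert x V)" using finite_V by simp
    have "pos x \<notin> pos ` V" using VI xI by force
    then show "inj_on pos (insert x V)" using inj x by simp
    show "e \<subseteq> insert x V \<and> card e = 2" if "e \<in> E \<union> N" for e
      using that edge[of e] fp xn by (auto simp: N_def)
    show "hull_of pos e \<inter> hull_of pos e' \<subseteq> pos ` (e \<inter> e')" if "e \<in> E \<union> N" "e' \<in> E \<union> N" "e \<noteq> e'" for e e'
    proof -
      have "hull_of pos e \<inter> hull_of pos e' \<subseteq> pos ` (e \<inter> e')" if "e \<in> N" "e' \<in> N"
      proof -
        obtain v w where vw: "v \<in> {a, b, c}" "e = {x, v}" "w \<in> {a, b, c}" "e' = {x, w}"
          using \<open>e \<in> N\<close> \<open>e' \<in> N\<close> unfolding N_def by auto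
        then have "v \<noteq> w" using \<open>e \<noteq> e'\<close> by auto
        from NN[OF vw(1,3) this] show ?thesis unfolding vw by blast
      qed
      moreover have "hull_of pos e \<inter> hull_of pos e' \<subseteq> pos ` (e \<inter> e')" if "e \<in> E" "e' \<in> N"
        using NE[OF that(2,1)] by (simp add: Int_commute)
      ultimately show ?thesis using that edge_inter NE by blast
    qed
    show "v \<in> e" if eEN: "e \<in> E \<union> N" and "v \<in> insert x V" "pos v \<in> hull_of pos e" for e v
    proof (cases "e \<in> E")
      case True
      then have "v \<noteq> x" using oldI xI that(3) by blast
      then show ?thesis using edge_vert True that by blast
    next
      case False
      then obtain w where w: "w \<in> {a, b, c}" "e = {x, w}" using eEN unfolding N_def by auto
      show ?thesis
      proof (cases "v = x")
        case False
        then have "v \<in> V" using that by blast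
        then have "pos v = pos w" using segN[OF w(1)] VI that(3) w(2) by blast
        then have "v = w" using inj \<open>v \<in> V\<close> w fp by (auto simp: inj_on_def)
        then show ?thesis using w by simp
      qed (use w in simp)
    qed
    show "card f = 3 \<and> \<not> collinear (pos ` f) \<and> (\<forall>u\<in>f. \<forall>v\<in>f. u \<noteq> v \<longrightarrow> {u, v} \<in> E \<union> N)"
      if "f \<in> T - {{a, b, c}} \<union> F" for f
    proof (cases "f \<in> F")
      case True
      have s: "{b, a} \<in> E" "{c, b} \<in> E" "{c, a} \<in> E" using fp by (simp_all add: insert_commute)
      have n: "{a, x} \<in> N" "{b, x} \<in> N" "{c, x} \<in> N" "{x, a} \<in> N" "{x, b} \<in> N" "{x, c} \<in> N"
        by (auto simp: N_def)
      show ?thesis using True unfolding F_def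
        by (elim insertE emptyE) (use fp xn s n in \<open>auto simp: card_3I sf'\<close>)
    next
      case False
      then show ?thesis using that face[of f] by blast
    qed
    show "interior (hull_of pos f) \<inter> hull_of pos e = {}" if "f \<in> T - {{a, b, c}} \<union> F" and eEN: "e \<in> E \<union> N" for f e
    proof (cases "f \<in> F")
      case True
      then show ?thesis using FN[OF True] intF[OF True] oldI that(2) by blast
    next
      case False
      then have f: "f \<in> T - {{a, b, c}}" using that by blast
      show ?thesis
      proof (cases "e \<in> E")
        case True then show ?thesis using face_edge f by blast
      next
        case False
        then obtain w where w: "w \<in> {a, b, c}" "e = {x, w}" using eEN unfolding N_def by auto
        then have "w \<in> V" using fp by auto
        then have "pos w \<notin> interior (hull_of pos f)" using face_vert f by blast
        then show ?thesis using segN[OF w(1)] TI[OF f] w(2) by blast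
      qed
    qed
    show "pos v \<notin> interior (hull_of pos f)" if "f \<in> T - {{a, b, c}} \<union> F" "v \<in> insert x V" for f v
    proof (cases "v = x")
      case True
      have "pos x \<in> hull_of pos {x, a}" by (simp del: hull_of_2 add: hull_of_def hull_inc)
      then have "pos x \<notin> interior (hull_of pos f)" if "f \<in> F" using FN[OF that, of "{x, a}"] by (auto simp: N_def)
      then show ?thesis using True that TI xI by blast
    next
      case False
      then show ?thesis using that VI intF face_vert by blast
    qed
    show "interior (hull_of pos f) \<inter> interior (hull_of pos g) = {}"
      if "f \<in> T - {{a, b, c}} \<union> F" "g \<in> T - {{a, b, c}} \<union> F" "f \<noteq> g" for f g
    proof (cases "f \<in> F"; cases "g \<in> F")
      assume "f \<in> F" "g \<in> F" then show ?thesis using FF that(3) by blast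
    next
      assume "f \<in> F" "g \<notin> F"
      then have "g \<in> T - {{a, b, c}}" using that by blast
      from TI[OF this] intF[OF \<open>f \<in> F\<close>] show ?thesis by blast
    next
      assume "f \<notin> F" "g \<in> F"
      then have "f \<in> T - {{a, b, c}}" using that by blast
      from TI[OF this] intF[OF \<open>g \<in> F\<close>] show ?thesis by blast
    next
      assume "f \<notin> F" "g \<notin> F" then show ?thesis using face_disj[of f g] that by blast
    qed
    show "card R = 3" "\<not> collinear (pos ` R)" by (rule rim)+
    show "{u, v} \<in> E \<union> N" if "u \<in> R" "v \<in> R" "u \<noteq> v" for u v using rim(3)[OF that] by blast
    have "hull_of pos {a, b, c} = (\<Union>f\<in>F. hull_of pos f)"
      unfolding F_def using stack_facts(8)[OF nc px'] by (simp add: Un_assoc)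
    then show "hull_of pos R = (\<Union>f\<in>T - {{a, b, c}} \<union> F. hull_of pos f)"
      using t unfolding cover by blast
    have "I \<subseteq> hull_of pos R" using t interior_subset unfolding cover I_def by blast
    then show "pos v \<in> hull_of pos R" if "v \<in> insert x V" for v using that xI inside by blast
  qed
qed

text \<open>A further face through \<open>b\<close> and \<open>c\<close>, bounded or not, would lose an edge when \<open>bc\<close> is removed; this is what
\<open>uniq\<close> and the last hypothesis exclude. The new edge runs through the two old faces and crosses
the old diagonal, so it meets no other part of the drawing.\<close>

lemma (in triangulated) flip:
  assumes t1: "{a, b, c} \<in> T" and t2: "{d, b, c} \<in> T"
    and P: "P \<in> open_segment (pos b) (pos c)" "P \<in> open_segment (pos a) (pos d)"
    and uniq: "\<And>t. t \<in> T \<Longrightarrow> {b, c} \<subseteq> t \<Longrightarrow> t \<in> {{a, b, c}, {d, b, c}}" and R: "\<not> {b, c} \<subseteq> R"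
  shows "triangulated pos V (E - {{b, c}} \<union> {{a, d}})
    (T - {{a, b, c}, {d, b, c}} \<union> {{a, b, d}, {a, c, d}}) R"
proof -
  define M where "M = interior (hull_of pos {a, b, c}) \<union> interior (hull_of pos {d, b, c}) \<union>
    open_segment (pos b) (pos c)"
  define F where "F = {{a, b, d}, {a, c, d}}"
  define E0 where "E0 = E - {{b, c}}"
  note fp1 = face_props[OF t1] and fp2 = face_props[OF t2]
  have ad: "a \<noteq> d" using P(2) by auto
  have nc2: "\<not> collinear {pos a, pos c, pos b}" using fp1(1) by (simp add: insert_commute)
  have P2: "P \<in> open_segment (pos c) (pos b)" using P(1) by (simp add: open_segment_commute)
  note ff = flip_facts(1-5)[OF fp1(1) P] flip_facts(1-5)[OF nc2 P2 P(2)]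
  have perm: "{pos a, pos c, pos b} = {pos a, pos b, pos c}" "{pos d, pos c, pos b} = {pos d, pos b, pos c}"
    by auto
  have hM: "M = interior (convex hull {pos a, pos b, pos c}) \<union> interior (convex hull {pos d, pos b, pos c}) \<union>
    open_segment (pos b) (pos c)" by (simp add: M_def)
  note ff' = ff[unfolded perm open_segment_commute[of "pos c" "pos b"], folded hM]
  have seg: "hull_of pos {a, d} \<subseteq> insert (pos a) (insert (pos d) M)" using ff' by simp
  have FM: "interior (hull_of pos f) \<subseteq> M" if "f \<in> F" for f using that ff' by (auto simp: F_def)
  have FS: "interior (hull_of pos f) \<inter> hull_of pos {a, d} = {}" if "f \<in> F" for f
    using that ff' by (auto simp: F_def)
  have FF: "interior (hull_of pos f) \<inter> interior (hull_of pos g) = {}" if "f \<in> F" "g \<in> F" "f \<noteq> g" for f g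
    using that unfolding F_def by (elim insertE emptyE) (simp_all add: ff')
  have Qsub: "open_segment (pos b) (pos c) \<subseteq> hull_of pos {b, c}"
    by (simp add: open_closed_segment subsetI)
  have ME: "M \<inter> hull_of pos e = {}" if "e \<in> E0" for e
  proof -
    have e: "e \<in> E" "e \<noteq> {b, c}" using that by (auto simp: E0_def)
    have "open_segment (pos b) (pos c) \<inter> hull_of pos e \<subseteq> pos ` {b, c}"
      using edge_inter[OF fp1(6) e(1)] e(2) Qsub by blast
    moreover have "pos b \<notin> open_segment (pos b) (pos c)" "pos c \<notin> open_segment (pos b) (pos c)"
      by (auto simp: open_segment_def)
    ultimately show ?thesis using face_edge[OF t1 e(1)] face_edge[OF t2 e(1)] unfolding M_def by blast
  qed
  have MV: "pos v \<notin> M" if "v \<in> V" for v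
  proof -
    have "pos v \<notin> open_segment (pos b) (pos c)"
    proof
      assume a: "pos v \<in> open_segment (pos b) (pos c)"
      then have "v \<in> {b, c}" using edge_vert[OF fp1(6) that] Qsub by blast
      then show False using a by (auto simp: open_segment_def)
    qed
    then show ?thesis using face_vert[OF t1 that] face_vert[OF t2 that] unfolding M_def by blast
  qed
  have MT: "interior (hull_of pos f) \<inter> M = {}" if "f \<in> T - {{a, b, c}, {d, b, c}}" for f
    using face_disj[OF _ t1, of f] face_disj[OF _ t2, of f] face_edge[OF _ fp1(6), of f] Qsub that
    unfolding M_def by blast
  have NE: "hull_of pos {a, d} \<inter> hull_of pos e \<subseteq> pos ` ({a, d} \<inter> e)" if "e \<in> E0" for e
  proof
    fix y assume y: "y \<in> hull_of pos {a, d} \<inter> hull_of pos e"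
    then have "y \<notin> M" using ME[OF that] by blast
    then consider "y = pos a" | "y = pos d" using y seg by blast
    then show "y \<in> pos ` ({a, d} \<inter> e)"
      using edge_vert[of e a] edge_vert[of e d] y fp1(8) fp2(8) that by cases (auto simp: E0_def)
  qed
  show ?thesis unfolding F_def[symmetric] E0_def[symmetric]
  proof
    show "finite V" "inj_on pos V" by (rule finite_V inj)+
    show "e \<subseteq> V \<and> card e = 2" if "e \<in> E0 \<union> {{a, d}}" for e
      using that edge[of e] fp1 fp2 ad by (auto simp: E0_def)
    show "hull_of pos e \<inter> hull_of pos e' \<subseteq> pos ` (e \<inter> e')"
      if "e \<in> E0 \<union> {{a, d}}" "e' \<in> E0 \<union> {{a, d}}" "e \<noteq> e'" for e e'
    proof (cases "e = {a, d}"; cases "e' = {a, d}")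
      assume "e = {a, d}" "e' = {a, d}" then show ?thesis using that(3) by simp
    next
      assume "e = {a, d}" "e' \<noteq> {a, d}"
      then show ?thesis using NE[of e'] that(2) by (simp del: hull_of_2)
    next
      assume "e \<noteq> {a, d}" "e' = {a, d}"
      then show ?thesis using NE[of e] that(1) by (simp del: hull_of_2 add: Int_commute)
    next
      assume "e \<noteq> {a, d}" "e' \<noteq> {a, d}"
      then have "e \<in> E" "e' \<in> E" using that by (auto simp: E0_def)
      from edge_inter[OF this that(3)] show ?thesis .
    qed
    show "v \<in> e" if "e \<in> E0 \<union> {{a, d}}" "v \<in> V" "pos v \<in> hull_of pos e" for e v
    proof (cases "e \<in> E0")
      case True then show ?thesis using edge_vert that by (auto simp: E0_def)
    next
      case False
      then have e: "e = {a, d}" using that by blast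
      then have "pos v = pos a \<or> pos v = pos d" using seg MV[OF that(2)] that(3) by blast
      then show ?thesis using inj fp1(8) fp2(8) that(2) e by (auto simp: inj_on_def)
    qed
    show "card f = 3 \<and> \<not> collinear (pos ` f) \<and> (\<forall>u\<in>f. \<forall>v\<in>f. u \<noteq> v \<longrightarrow> {u, v} \<in> E0 \<union> {{a, d}})"
      if "f \<in> T - {{a, b, c}, {d, b, c}} \<union> F" for f
    proof (cases "f \<in> F")
      case True
      have e: "{a, b} \<in> E0" "{a, c} \<in> E0" "{b, d} \<in> E0" "{c, d} \<in> E0"
        "{b, a} \<in> E0" "{c, a} \<in> E0" "{d, b} \<in> E0" "{d, c} \<in> E0" "{d, a} = {a, d}"
        using fp1 fp2 by (auto simp: E0_def insert_commute doubleton_eq_iff)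
      show ?thesis using True unfolding F_def
        by (elim insertE emptyE) (use fp1 fp2 ad e in \<open>auto simp: card_3I ff'\<close>)
    next
      case False
      then have f: "f \<in> T" "f \<notin> {{a, b, c}, {d, b, c}}" using that by auto
      with uniq[of f] have f: "f \<in> T" "\<not> {b, c} \<subseteq> f" by auto
      have "{u, v} \<noteq> {b, c}" if "u \<in> f" "v \<in> f" for u v
      proof
        assume "{u, v} = {b, c}"
        moreover have "{u, v} \<subseteq> f" using that by simp
        ultimately show False using f(2) by simp
      qed
      then show ?thesis using face[OF f(1)] by (simp add: E0_def)
    qed
    show "interior (hull_of pos f) \<inter> hull_of pos e = {}"
      if "f \<in> T - {{a, b, c}, {d, b, c}} \<union> F" "e \<in> E0 \<union> {{a, d}}" for f e
    proof (cases "f \<in> F")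
      case True then show ?thesis using FS[OF True] FM[OF True] ME that(2) by blast
    next
      case False
      then have f: "f \<in> T - {{a, b, c}, {d, b, c}}" using that by blast
      then have "pos a \<notin> interior (hull_of pos f)" "pos d \<notin> interior (hull_of pos f)"
        using face_vert fp1(8) fp2(8) by blast+
      then have "interior (hull_of pos f) \<inter> hull_of pos {a, d} = {}" using seg MT[OF f] by blast
      moreover have "interior (hull_of pos f) \<inter> hull_of pos e = {}" if "e \<in> E0"
        using face_edge[of f e] f that unfolding E0_def by blast
      ultimately show ?thesis using \<open>e \<in> E0 \<union> {{a, d}}\<close> by blast
    qed
    show "pos v \<notin> interior (hull_of pos f)" if "f \<in> T - {{a, b, c}, {d, b, c}} \<union> F" "v \<in> V" for f v
      using that MV FM face_vert by blast
    show "interior (hull_of pos f) \<inter> interior (hull_of pos g) = {}"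
      if "f \<in> T - {{a, b, c}, {d, b, c}} \<union> F" "g \<in> T - {{a, b, c}, {d, b, c}} \<union> F" "f \<noteq> g" for f g
    proof (cases "f \<in> F"; cases "g \<in> F")
      assume "f \<in> F" "g \<in> F" then show ?thesis using FF that(3) by blast
    next
      assume "f \<in> F" "g \<notin> F"
      then have "g \<in> T - {{a, b, c}, {d, b, c}}" using that by blast
      from MT[OF this] FM[OF \<open>f \<in> F\<close>] show ?thesis by blast
    next
      assume "f \<notin> F" "g \<in> F"
      then have "f \<in> T - {{a, b, c}, {d, b, c}}" using that by blast
      from MT[OF this] FM[OF \<open>g \<in> F\<close>] show ?thesis by blast
    next
      assume "f \<notin> F" "g \<notin> F" then show ?thesis using face_disj[of f g] that by blast
    qed
    show "card R = 3" "\<not> collinear (pos ` R)" by (rule rim)+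
    show "{u, v} \<in> E0 \<union> {{a, d}}" if "u \<in> R" "v \<in> R" "u \<noteq> v" for u v
    proof -
      have "{u, v} \<noteq> {b, c}"
      proof
        assume "{u, v} = {b, c}"
        moreover have "{u, v} \<subseteq> R" using that by simp
        ultimately show False using R by simp
      qed
      then show ?thesis using rim(3)[OF that] by (simp add: E0_def)
    qed
    have "hull_of pos {a, b, c} \<union> hull_of pos {d, b, c} = (\<Union>f\<in>F. hull_of pos f)"
      unfolding F_def using flip_facts(6)[OF fp1(1) P] by simp
    then show "hull_of pos R = (\<Union>f\<in>T - {{a, b, c}, {d, b, c}} \<union> F. hull_of pos f)"
      using t1 t2 unfolding cover by blast
    show "pos v \<in> hull_of pos R" if "v \<in> V" for v by (rule inside[OF that])
  qed
qed

section \<open>From the invariant to planar triangulations\<close>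

text \<open>A connected set that avoids \<open>D\<close> and whose frontier lies in \<open>D\<close> cannot be left without
crossing \<open>D\<close>. So faces can be identified without the Jordan curve theorem.\<close>

lemma component_eqI:
  assumes "C \<in> components (- D)" "connected U" "U \<inter> D = {}" "frontier U \<subseteq> D" "C \<inter> U \<noteq> {}"
  shows "C = U"
proof (rule equalityI)
  have C: "connected C" "C \<subseteq> - D"
    using assms(1) in_components_connected in_components_subset by blast+
  show "U \<subseteq> C" using components_maximal[OF assms(1,2)] assms(3,5) by blast
  show "C \<subseteq> U"
  proof (rule ccontr)
    assume "\<not> C \<subseteq> U"
    then have "C \<inter> frontier U \<noteq> {}" using connected_Int_frontier[OF C(1) assms(5)] by blast
    then show False using C(2) assms(4) by blast
  qed
qed

lemma interior_triangle_nonempty: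
  fixes a b c :: complex
  assumes "\<not> collinear {a, b, c}"
  shows "interior (convex hull {a, b, c}) \<noteq> {}"
proof -
  have "bary a b c (1/3) (1/3) (1/3) \<in> interior (convex hull {a, b, c})"
    unfolding interior_bary[OF assms] by (intro exI[of _ "1/3"]) simp
  then show ?thesis by blast
qed

lemma frontier_interior_triangle:
  fixes a b c :: complex
  assumes "\<not> collinear {a, b, c}"
  shows "frontier (interior (convex hull {a, b, c})) = closed_segment a b \<union> closed_segment b c \<union> closed_segment a c"
proof -
  have "frontier (interior (convex hull {a, b, c})) = frontier (convex hull {a, b, c})"
    using convex_closure_interior[OF convex_convex_hull interior_triangle_nonempty[OF assms]]
    by (simp add: frontier_def)
  then show ?thesis by (simp add: frontier_of_triangle closed_segment_commute)
qed

definition straight :: "(nat \<Rightarrow> complex) \<Rightarrow> nat set \<Rightarrow> real \<Rightarrow> complex" where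
  "straight pos e = linepath (pos (Min e)) (pos (Max e))"

lemma straight_pair:
  assumes "u \<noteq> v"
  shows "path_image (straight pos {u, v}) = closed_segment (pos u) (pos v)"
    "{pathstart (straight pos {u, v}), pathfinish (straight pos {u, v})} = {pos u, pos v}"
    "pos u \<noteq> pos v \<Longrightarrow> arc (straight pos {u, v})"
  using assms unfolding straight_def
  by (cases "u < v"; auto simp: min_def max_def closed_segment_commute arc_linepath)+

text \<open>A point off the drawing lies outside \<open>R\<close> or, by \<open>cover\<close>, inside a triangle of \<open>T\<close>; either
region has a triangle of the drawing as its frontier.\<close>

theorem triangulated_planar_triangulation:
  fixes pos :: "nat \<Rightarrow> complex"
  assumes "triangulated pos V E T R"
  shows "planar_triangulation (V, E)"
proof -
  interpret triangulated pos V E T R by fact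
  let ?\<gamma> = "straight pos"
  have E2: "\<exists>u v. e = {u, v} \<and> u \<noteq> v \<and> u \<in> V \<and> v \<in> V \<and> pos u \<noteq> pos v" if eE: "e \<in> E" for e
  proof -
    obtain u v where uv: "e = {u, v}" "u \<noteq> v" using edge[OF eE] card_2_iff by metis
    then have "u \<in> V" "v \<in> V" using edge[OF eE] by auto
    then show ?thesis using uv inj_onD[OF inj] by blast
  qed
  have img: "path_image (?\<gamma> e) = hull_of pos e" if "e \<in> E" for e
    using E2[OF that] straight_pair(1) by auto
  have dr: "drawing (V, E) pos ?\<gamma> = pos ` V \<union> (\<Union>e\<in>E. hull_of pos e)"
    by (simp add: drawing_def img)
  obtain r1 r2 r3 where r: "R = {r1, r2, r3}" "r1 \<noteq> r2" "r2 \<noteq> r3" "r1 \<noteq> r3"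
    using rim(1) by (auto simp: card_3_iff)
  have rE: "{r1, r2} \<in> E" "{r2, r3} \<in> E" "{r1, r3} \<in> E" using rim(3) r by auto
  have simple: "simple_graph (V, E)"
    unfolding simple_graph_def using finite_V edge rE by fastforce
  have emb: "plane_embedding (V, E) pos ?\<gamma>"
    unfolding plane_embedding_def
  proof (intro conjI ballI impI)
    show "inj_on pos (verts (V, E))" using inj by simp
  next
    fix e assume "e \<in> edges (V, E)"
    then have e: "e \<in> E" by simp
    obtain u v where uv: "e = {u, v}" "u \<noteq> v" "pos u \<noteq> pos v" using E2[OF e] by blast
    show "arc (?\<gamma> e)" "{pathstart (?\<gamma> e), pathfinish (?\<gamma> e)} = pos ` e"
      using straight_pair[OF uv(2)] uv by auto
    show "path_image (?\<gamma> e) \<inter> pos ` verts (V, E) = pos ` e"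
      using edge_vert[OF e] vert_hull[of _ e] edge[OF e] unfolding img[OF e] by auto
  next
    fix e e' assume "e \<in> edges (V, E)" "e' \<in> edges (V, E)" and ne: "e \<noteq> e'"
    then have e: "e \<in> E" "e' \<in> E" by auto
    have "pos ` (e \<inter> e') \<subseteq> hull_of pos e \<inter> hull_of pos e'" using vert_hull by blast
    then show "path_image (?\<gamma> e) \<inter> path_image (?\<gamma> e') = pos ` (e \<inter> e')"
      using edge_inter[OF e ne] unfolding img[OF e(1)] img[OF e(2)] by blast
  qed
  have tri: "triangular_face (V, E) ?\<gamma> C"
    if C: "C \<in> components (- drawing (V, E) pos ?\<gamma>)" "connected U" "U \<inter> drawing (V, E) pos ?\<gamma> = {}" "C \<inter> U \<noteq> {}"
      and f: "frontier U = closed_segment (pos u) (pos v) \<union> closed_segment (pos v) (pos w) \<union> closed_segment (pos u) (pos w)"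
      and d: "u \<noteq> v" "v \<noteq> w" "u \<noteq> w" and uvw: "{u, v} \<in> E" "{v, w} \<in> E" "{u, w} \<in> E" for C U u v w
  proof -
    have fr: "frontier U = hull_of pos {u, v} \<union> hull_of pos {v, w} \<union> hull_of pos {u, w}" using f by simp
    then have "frontier U \<subseteq> drawing (V, E) pos ?\<gamma>" unfolding dr using uvw by blast
    from component_eqI[OF C(1-3) this C(4)] have "C = U" .
    then show ?thesis unfolding triangular_face_def
      using uvw d fr img by (intro exI[of _ u] exI[of _ v] exI[of _ w]) simp
  qed
  have "triangular_face (V, E) ?\<gamma> C" if C: "C \<in> faces (V, E) pos ?\<gamma>" for C
  proof -
    have C': "C \<in> components (- drawing (V, E) pos ?\<gamma>)" using C by (simp add: faces_def)
    then obtain x where x: "x \<in> C" "x \<notin> drawing (V, E) pos ?\<gamma>"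
      using in_components_nonempty in_components_subset by blast
    show ?thesis
    proof (cases "x \<in> hull_of pos R")
      case True
      then obtain t where t: "t \<in> T" "x \<in> hull_of pos t" unfolding cover by blast
      obtain a b c where abc: "t = {a, b, c}" using face[OF t(1)] by (auto simp: card_3_iff)
      note fp = face_props[OF t(1)[unfolded abc]]
      have "x \<notin> closed_segment (pos a) (pos b) \<union> closed_segment (pos b) (pos c) \<union> closed_segment (pos c) (pos a)"
        using x(2) fp(5-7) unfolding dr by (force simp: closed_segment_commute)
      then have xi: "x \<in> interior (hull_of pos t)"
        using t(2) unfolding abc by (simp add: interior_of_triangle)
      show ?thesis
      proof (rule tri[OF C', of "interior (hull_of pos t)" a b c])
        show "connected (interior (hull_of pos t))"
          unfolding hull_of_def by (intro convex_connected convex_interior convex_convex_hull)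
        show "interior (hull_of pos t) \<inter> drawing (V, E) pos ?\<gamma> = {}"
          unfolding dr using face_edge[OF t(1)] face_vert[OF t(1)] by blast
        show "C \<inter> interior (hull_of pos t) \<noteq> {}" using x xi by blast
        show "frontier (interior (hull_of pos t)) = closed_segment (pos a) (pos b) \<union>
            closed_segment (pos b) (pos c) \<union> closed_segment (pos a) (pos c)"
          unfolding abc using frontier_interior_triangle[OF fp(1)] by simp
      qed (use fp in auto)
    next
      case False
      have sub: "drawing (V, E) pos ?\<gamma> \<subseteq> hull_of pos R"
      proof -
        have "hull_of pos e \<subseteq> hull_of pos R" if "e \<in> E" for e
          unfolding hull_of_def[of _ e] using edge[OF that] inside
          by (intro hull_minimal) (auto simp: hull_of_def)
        then show ?thesis unfolding dr using inside by blast
      qed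
      show ?thesis
      proof (rule tri[OF C', of "- hull_of pos R" r1 r2 r3])
        show "connected (- hull_of pos R)" unfolding hull_of_def r
          by (rule connected_complement_bounded_convex) (auto intro: bounded_convex_hull)
        show "- hull_of pos R \<inter> drawing (V, E) pos ?\<gamma> = {}" using sub by blast
        show "C \<inter> - hull_of pos R \<noteq> {}" using x False by blast
        show "frontier (- hull_of pos R) = closed_segment (pos r1) (pos r2) \<union>
            closed_segment (pos r2) (pos r3) \<union> closed_segment (pos r1) (pos r3)"
          unfolding r by (simp add: frontier_complement frontier_of_triangle closed_segment_commute)
      qed (use r rE in auto)
    qed
  qed
  then show ?thesis unfolding planar_triangulation_def using simple emb by blast
qed

section \<open>Drawings with integer coordinates\<close>

definition orient :: "(nat \<Rightarrow> int) \<Rightarrow> (nat \<Rightarrow> int) \<Rightarrow> nat \<Rightarrow> nat \<Rightarrow> nat \<Rightarrow> int" where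
  "orient X Y i j k = (X j - X i) * (Y k - Y i) - (Y j - Y i) * (X k - X i)"

definition encloses :: "(nat \<Rightarrow> int) \<Rightarrow> (nat \<Rightarrow> int) \<Rightarrow> nat \<Rightarrow> nat \<Rightarrow> nat \<Rightarrow> nat \<Rightarrow> bool" where
  "encloses X Y a b c x \<longleftrightarrow>
     orient X Y b c x > 0 \<and> orient X Y c a x > 0 \<and> orient X Y a b x > 0 \<or>
     orient X Y b c x < 0 \<and> orient X Y c a x < 0 \<and> orient X Y a b x < 0"

definition crossing :: "(nat \<Rightarrow> int) \<Rightarrow> (nat \<Rightarrow> int) \<Rightarrow> nat \<Rightarrow> nat \<Rightarrow> nat \<Rightarrow> nat \<Rightarrow> bool" where
  "crossing X Y a d b c \<longleftrightarrow>
     orient X Y a d b * orient X Y a d c < 0 \<and> orient X Y b c a * orient X Y b c d < 0"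

text \<open>The vertices 0, 1, 2 form the outer triangle and new vertices are numbered in the order of
their insertion. In a flip, the removed edge has to have an inner end, so that it is not an edge of
the outer triangle, which belongs to the drawing that receives this one.\<close>

inductive drawn :: "(nat \<Rightarrow> int) \<Rightarrow> (nat \<Rightarrow> int) \<Rightarrow> nat \<Rightarrow> nat set set \<Rightarrow> nat set set \<Rightarrow> bool" for X Y where
  drawn_init: "drawn X Y 3 {{0, 1}, {0, 2}, {1, 2}} {{0, 1, 2}}"
| drawn_stack: "drawn X Y n E T \<Longrightarrow> {a, b, c} \<in> T \<Longrightarrow> encloses X Y a b c n \<Longrightarrow>
    drawn X Y (Suc n) (E \<union> {{n, a}, {n, b}, {n, c}}) (T - {{a, b, c}} \<union> {{a, b, n}, {b, c, n}, {a, c, n}})"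
| drawn_flip: "drawn X Y n E T \<Longrightarrow> {a, b, c} \<in> T \<Longrightarrow> {d, b, c} \<in> T \<Longrightarrow> crossing X Y a d b c \<Longrightarrow>
    3 \<le> b \<or> 3 \<le> c \<Longrightarrow> (\<forall>t\<in>T. b \<in> t \<and> c \<in> t \<longrightarrow> t = {a, b, c} \<or> t = {d, b, c}) \<Longrightarrow>
    drawn X Y n (E - {{b, c}} \<union> {{a, d}}) (T - {{a, b, c}, {d, b, c}} \<union> {{a, b, d}, {a, c, d}})"

lemma drawn_wf:
  "drawn X Y n E T \<Longrightarrow> 3 \<le> n \<and> (\<forall>e\<in>E. e \<subseteq> {..<n}) \<and> (\<forall>t\<in>T. t \<subseteq> {..<n} \<and> card t = 3)"
proof (induction rule: drawn.induct)
  case drawn_init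
  show ?case by auto
next
  case (drawn_stack n E T a b c)
  have abc: "{a, b, c} \<subseteq> {..<n}" "card {a, b, c} = 3"
    using drawn_stack.IH drawn_stack.hyps(2) by metis+
  then have d: "a \<noteq> b" "b \<noteq> c" "a \<noteq> c" "a < n" "b < n" "c < n"
    by (auto simp: card_insert_if split: if_splits)
  have up: "s \<subseteq> {..<Suc n}" if "s \<subseteq> {..<n}" for s using that by auto
  have new: "e \<subseteq> {..<Suc n}" if "e \<in> {{n, a}, {n, b}, {n, c}}" for e
    using that d by (elim insertE emptyE) simp_all
  have new': "t \<subseteq> {..<Suc n} \<and> card t = 3" if "t \<in> {{a, b, n}, {b, c, n}, {a, c, n}}" for t
    using that d by (elim insertE emptyE) simp_all
  have 1: "3 \<le> Suc n" using drawn_stack.IH by simp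
  have 2: "e \<subseteq> {..<Suc n}" if "e \<in> E \<union> {{n, a}, {n, b}, {n, c}}" for e
    using that drawn_stack.IH up new by (metis UnE)
  have 3: "t \<subseteq> {..<Suc n} \<and> card t = 3"
    if "t \<in> T - {{a, b, c}} \<union> {{a, b, n}, {b, c, n}, {a, c, n}}" for t
    using that drawn_stack.IH up new' by (metis UnE DiffD1)
  show ?case
    by (intro conjI ballI) (rule 1, erule 2, erule 3[THEN conjunct1], erule 3[THEN conjunct2])
next
  case (drawn_flip n E T a b c d)
  have abc: "{a, b, c} \<subseteq> {..<n}" "card {a, b, c} = 3" "{d, b, c} \<subseteq> {..<n}" "card {d, b, c} = 3"
    using drawn_flip.IH drawn_flip.hyps(2,3) by metis+
  have "a \<noteq> d" using drawn_flip(4) by (auto simp: crossing_def orient_def)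
  then have d: "a \<noteq> b" "b \<noteq> c" "a \<noteq> c" "a < n" "b < n" "c < n" "d < n" "d \<noteq> b" "d \<noteq> c" "a \<noteq> d"
    using abc by (auto simp: card_insert_if split: if_splits)
  have new: "t \<subseteq> {..<n} \<and> card t = 3" if "t \<in> {{a, b, d}, {a, c, d}}" for t
    using that d by (elim insertE emptyE) simp_all
  have 2: "e \<subseteq> {..<n}" if "e \<in> E - {{b, c}} \<union> {{a, d}}" for e
    using that drawn_flip.IH d by (elim UnE) auto
  have 3: "t \<subseteq> {..<n} \<and> card t = 3"
    if "t \<in> T - {{a, b, c}, {d, b, c}} \<union> {{a, b, d}, {a, c, d}}" for t
    using that drawn_flip.IH new by (metis UnE DiffD1)
  have 1: "3 \<le> n" using drawn_flip.IH by simp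
  show ?case
    by (intro conjI ballI) (rule 1, erule 2, erule 3[THEN conjunct1], erule 3[THEN conjunct2])
qed

context
  fixes X Y :: "nat \<Rightarrow> int" and z u w :: complex and A :: "nat \<Rightarrow> complex"
  assumes A: "A = (\<lambda>i. z + real_of_int (X i) *\<^sub>R u + real_of_int (Y i) *\<^sub>R w)"
begin

text \<open>Incidences are checked as affine relations between integer points; these are inherited by the
images of the points under an affine map.\<close>

lemma affine_comb:
  fixes p q r s :: int
  assumes "p * X a + q * X b + r * X c + s * X d = 0" "p * Y a + q * Y b + r * Y c + s * Y d = 0"
    and "p + q + r + s = 0"
  shows "real_of_int p *\<^sub>R A a + real_of_int q *\<^sub>R A b + real_of_int r *\<^sub>R A c + real_of_int s *\<^sub>R A d = 0"
proof -
  have "real_of_int p *\<^sub>R A a + real_of_int q *\<^sub>R A b + real_of_int r *\<^sub>R A c + real_of_int s *\<^sub>R A d =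
      real_of_int (p + q + r + s) *\<^sub>R z + real_of_int (p * X a + q * X b + r * X c + s * X d) *\<^sub>R u +
      real_of_int (p * Y a + q * Y b + r * Y c + s * Y d) *\<^sub>R w"
    unfolding A by (simp add: scaleR_add_right scaleR_add_left)
  then show ?thesis unfolding assms by simp
qed

lemma orient_comb:
  "real_of_int (orient X Y b c x) *\<^sub>R A a + real_of_int (orient X Y c a x) *\<^sub>R A b +
   real_of_int (orient X Y a b x) *\<^sub>R A c +
   real_of_int (- (orient X Y b c x + orient X Y c a x + orient X Y a b x)) *\<^sub>R A x = 0"
  by (rule affine_comb) (simp_all add: orient_def algebra_simps)

lemma encloses_interior:
  assumes "encloses X Y a b c x" "\<not> collinear {A a, A b, A c}"
  shows "A x \<in> interior (convex hull {A a, A b, A c})"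
proof -
  define p q r where pqr: "p = real_of_int (orient X Y b c x)" "q = real_of_int (orient X Y c a x)"
    "r = real_of_int (orient X Y a b x)"
  define S where "S = p + q + r"
  have sgn: "0 < p \<and> 0 < q \<and> 0 < r \<or> p < 0 \<and> q < 0 \<and> r < 0"
    using assms(1) by (auto simp: encloses_def pqr)
  then have S: "S \<noteq> 0" "0 < p / S" "0 < q / S" "0 < r / S"
    by (auto simp: S_def zero_less_divide_iff)
  have "p *\<^sub>R A a + q *\<^sub>R A b + r *\<^sub>R A c = S *\<^sub>R A x"
    using orient_comb[of b c x a] by (simp add: pqr S_def scaleR_add_left algebra_simps)
  then have "inverse S *\<^sub>R (p *\<^sub>R A a + q *\<^sub>R A b + r *\<^sub>R A c) = A x" using S(1) by simp
  then have "A x = bary (A a) (A b) (A c) (p / S) (q / S) (r / S)"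
    by (simp add: bary_def scaleR_add_right divide_inverse mult.commute)
  moreover have "p / S + q / S + r / S = 1" using S(1) by (simp add: S_def add_divide_distrib[symmetric])
  ultimately show ?thesis unfolding interior_bary[OF assms(2)] using S by blast
qed

lemma crossing_segments:
  assumes "crossing X Y a d b c" "A b \<noteq> A c" "A a \<noteq> A d"
  shows "\<exists>P. P \<in> open_segment (A b) (A c) \<and> P \<in> open_segment (A a) (A d)"
proof -
  define p q r s where pq: "p = real_of_int (orient X Y a d b)" "q = real_of_int (orient X Y a d c)"
    "r = real_of_int (orient X Y b c a)" "s = real_of_int (orient X Y b c d)"
  have "p * q < 0" "r * s < 0"
    using assms(1) unfolding crossing_def pq by (metis of_int_mult of_int_less_0_iff)+
  then have pq': "p > 0 \<and> q < 0 \<or> p < 0 \<and> q > 0" "r > 0 \<and> s < 0 \<or> r < 0 \<and> s > 0"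
    by (auto simp: mult_less_0_iff)
  have "real_of_int (- orient X Y a d c) *\<^sub>R A b + real_of_int (orient X Y a d b) *\<^sub>R A c +
      real_of_int (- orient X Y b c d) *\<^sub>R A a + real_of_int (orient X Y b c a) *\<^sub>R A d = 0"
    by (rule affine_comb) (simp_all add: orient_def algebra_simps)
  then have e: "p *\<^sub>R A c - q *\<^sub>R A b = s *\<^sub>R A a - r *\<^sub>R A d" by (simp add: pq algebra_simps)
  have d: "p - q = s - r" unfolding pq orient_def by (simp add: algebra_simps)
  define D where "D = p - q"
  have D0: "D \<noteq> 0" using pq' by (auto simp: D_def)
  have l: "0 < p / D" "p / D < 1" using pq'(1) by (auto simp: D_def divide_simps)
  have "0 < - r / D" "- r / D < 1" using pq'(2) unfolding D_def d by (auto simp: divide_simps)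
  then have m: "0 < - r / D" "- r / D < 1" by auto
  define P where "P = inverse D *\<^sub>R (p *\<^sub>R A c - q *\<^sub>R A b)"
  have c: "1 - p / D = - q / D" "1 - (- r / D) = s / D" using D0 d by (simp_all add: D_def field_simps)
  have "P = (1 - p / D) *\<^sub>R A b + (p / D) *\<^sub>R A c"
    unfolding c by (simp add: P_def scaleR_diff_right divide_inverse mult.commute)
  moreover have "P = (1 - (- r / D)) *\<^sub>R A a + (- r / D) *\<^sub>R A d"
    unfolding c by (simp add: P_def e scaleR_diff_right divide_inverse mult.commute)
  ultimately have "P \<in> open_segment (A b) (A c)" "P \<in> open_segment (A a) (A d)"
    unfolding in_segment using l m assms(2,3) by blast+
  then show ?thesis by blast
qed

end

lemma (in triangulated) face_subset:
  assumes "t \<in> T"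
  shows "t \<subseteq> V"
proof -
  obtain a b c where "t = {a, b, c}" using face[OF assms] card_3_iff by metis
  then show ?thesis using face_props(8-10)[of a b c] assms by simp
qed

lemma (in triangulated) rim_subset: "R \<subseteq> V"
proof
  fix v assume v: "v \<in> R"
  obtain a b c where "R = {a, b, c}" "a \<noteq> b" using rim(1) card_3_iff by metis
  then obtain u where "u \<in> R" "u \<noteq> v" by auto
  then show "v \<in> V" using rim(3)[of u v] v edge by blast
qed

lemma triangulated_cong:
  assumes tr: "triangulated pos V E T R" and eq: "\<And>v. v \<in> V \<Longrightarrow> pos' v = pos v"
  shows "triangulated pos' V E T R"
proof -
  interpret triangulated pos V E T R by fact
  have im: "pos' ` s = pos ` s" if "s \<subseteq> V" for s using eq that by (auto intro!: image_cong)
  have h: "hull_of pos' s = hull_of pos s" if "s \<subseteq> V" for s unfolding hull_of_def using im[OF that] by simp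
  have E: "e \<subseteq> V" if "e \<in> E" for e using edge[OF that] by simp
  have T: "t \<subseteq> V" if "t \<in> T" for t by (rule face_subset[OF that])
  have R: "R \<subseteq> V" by (rule rim_subset)
  show ?thesis
  proof
    show "finite V" by (rule finite_V)
    show "inj_on pos' V" using inj eq by (simp add: inj_on_def)
    show "e \<subseteq> V \<and> card e = 2" if "e \<in> E" for e using edge[OF that] .
    show "hull_of pos' e \<inter> hull_of pos' e' \<subseteq> pos' ` (e \<inter> e')" if "e \<in> E" "e' \<in> E" "e \<noteq> e'" for e e'
      using edge_inter[OF that] E[OF that(1)] E[OF that(2)] by (simp add: h im le_infI1)
    show "v \<in> e" if "e \<in> E" "v \<in> V" "pos' v \<in> hull_of pos' e" for e v
      using edge_vert[OF that(1,2)] that E by (simp add: h eq)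
    show "card t = 3 \<and> \<not> collinear (pos' ` t) \<and> (\<forall>u\<in>t. \<forall>v\<in>t. u \<noteq> v \<longrightarrow> {u, v} \<in> E)" if "t \<in> T" for t
      using face[OF that] im[OF T[OF that]] by simp
    show "interior (hull_of pos' t) \<inter> hull_of pos' e = {}" if "t \<in> T" "e \<in> E" for t e
      using face_edge[OF that] T E that by (simp add: h)
    show "pos' v \<notin> interior (hull_of pos' t)" if "t \<in> T" "v \<in> V" for t v
      using face_vert[OF that] T that by (simp add: h eq)
    show "interior (hull_of pos' t) \<inter> interior (hull_of pos' t') = {}" if "t \<in> T" "t' \<in> T" "t \<noteq> t'" for t t'
      using face_disj[OF that] T that by (simp add: h)
    show "card R = 3" by (rule rim)
    show "\<not> collinear (pos' ` R)" using rim(2) im[OF R] by simp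
    show "{u, v} \<in> E" if "u \<in> R" "v \<in> R" "u \<noteq> v" for u v using rim(3)[OF that] .
    show "hull_of pos' R = (\<Union>t\<in>T. hull_of pos' t)" using cover T by (simp add: h R)
    show "pos' v \<in> hull_of pos' R" if "v \<in> V" for v using inside[OF that] by (simp add: h R eq that)
  qed
qed

lemma image_Diff_single:
  assumes "inj_on f S" "\<And>a. a \<in> A \<Longrightarrow> a \<subseteq> S" "b \<subseteq> S"
  shows "image f ` (A - {b}) = image f ` A - {f ` b}"
proof -
  have "f ` a \<noteq> f ` b" if "a \<in> A" "a \<noteq> b" for a
    using inj_on_image_eq_iff[OF assms(1) assms(2)[OF that(1)] assms(3)] that(2) by simp
  then show ?thesis by blast
qed

lemma two_removed: "x \<notin> S \<Longrightarrow> y \<notin> S \<Longrightarrow> S \<union> I - {x, y} = S \<union> (I - {x} - {y})"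
  by blast

text \<open>Each move of the integer drawing is repeated, under the names \<open>\<phi>\<close> and an affine map, inside
the face \<open>\<phi> 0\<close>, \<open>\<phi> 1\<close>, \<open>\<phi> 2\<close>. All positions are fixed beforehand, so only the graph changes
along the induction. Fresh names keep the new faces and edges apart from the old ones.\<close>

theorem insert_drawn:
  assumes tr: "triangulated pos V E T R" and dr: "drawn X Y n El Tl"
    and t0: "{\<phi> 0, \<phi> 1, \<phi> 2} \<in> T" and inj: "inj_on \<phi> {..<n}" and fresh: "\<And>i. 3 \<le> i \<Longrightarrow> i < n \<Longrightarrow> \<phi> i \<notin> V"
    and rim: "X 0 = 0" "Y 0 = 0" "X 1 = N" "Y 1 = 0" "X 2 = 0" "Y 2 = N" "N \<noteq> 0"
  shows "\<exists>pos'. triangulated pos' (V \<union> \<phi> ` {3..<n}) (E \<union> image \<phi> ` El)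
           (T - {{\<phi> 0, \<phi> 1, \<phi> 2}} \<union> image \<phi> ` Tl) R"
proof -
  define A where "A = (\<lambda>i. pos (\<phi> 0) + real_of_int (X i) *\<^sub>R ((pos (\<phi> 1) - pos (\<phi> 0)) /\<^sub>R real_of_int N)
    + real_of_int (Y i) *\<^sub>R ((pos (\<phi> 2) - pos (\<phi> 0)) /\<^sub>R real_of_int N))"
  \<comment> \<open>the affine map that sends the outer triangle of the integer drawing to the given face\<close>
  define pos' where "pos' = (\<lambda>v. if v \<in> V then pos v else A (inv_into {..<n} \<phi> v))"
  have tr0: "triangulated pos' V E T R"
    by (rule triangulated_cong[OF tr]) (simp add: pos'_def)
  interpret G: triangulated pos' V E T R by (rule tr0)
  have n3: "3 \<le> n" using drawn_wf[OF dr] by simp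
  have V0: "\<phi> 0 \<in> V" "\<phi> 1 \<in> V" "\<phi> 2 \<in> V" using G.face_props[OF t0] by auto
  have A0: "A 0 = pos (\<phi> 0)" "A 1 = pos (\<phi> 1)" "A 2 = pos (\<phi> 2)" using rim by (auto simp: A_def)
  have pA: "pos' (\<phi> i) = A i" if "i < n" for i
  proof (cases "3 \<le> i")
    case True
    then show ?thesis using fresh[OF True that] inv_into_f_f[OF inj, of i] that by (simp add: pos'_def)
  next
    case False
    then have "i = 0 \<or> i = 1 \<or> i = 2" by linarith
    then show ?thesis using V0 A0 by (auto simp: pos'_def)
  qed
  have injp: "\<phi> i = \<phi> j \<longleftrightarrow> i = j" if "i < n" "j < n" for i j using inj that by (auto simp: inj_on_def)
  let ?t0 = "{\<phi> 0, \<phi> 1, \<phi> 2}"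
  have newT: "\<phi> ` f \<notin> T - {?t0}" if "f \<subseteq> {..<n}" "card f = 3" for f
  proof (cases "f \<subseteq> {..<3}")
    case True
    then have "f = {..<3}" using that(2) by (simp add: card_subset_eq)
    also have "{..<3::nat} = {0, 1, 2}" by auto
    finally show ?thesis by simp
  next
    case False
    then obtain i where "i \<in> f" "3 \<le> i" by force
    then have "\<phi> i \<notin> V" using fresh that(1) by auto
    then show ?thesis using G.face_subset \<open>i \<in> f\<close> by blast
  qed
  have newE: "\<phi> ` {b, c} \<notin> E" if "b < n" "c < n" "3 \<le> b \<or> 3 \<le> c" for b c
    using fresh that G.edge by fastforce
  have "triangulated pos' (V \<union> \<phi> ` {3..<m}) (E \<union> image \<phi> ` Em) (T - {?t0} \<union> image \<phi> ` Tm) R"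
    if "drawn X Y m Em Tm" "m \<le> n" for m Em Tm
    using that
  proof (induction rule: drawn.induct)
    case drawn_init
    have "T - {?t0} \<union> image \<phi> ` {{0, 1, 2}} = T" using t0 by auto
    moreover have "E \<union> image \<phi> ` {{0, 1}, {0, 2}, {1, 2}} = E" using G.face_props[OF t0] by auto
    ultimately show ?case using tr0 by simp
  next
    case (drawn_stack m E' T' a b c)
    note wf = drawn_wf[OF drawn_stack.hyps(1)]
    let ?T = "T - {?t0} \<union> image \<phi> ` T'"
    have mn: "m < n" using drawn_stack.prems by simp
    interpret H: triangulated pos' "V \<union> \<phi> ` {3..<m}" "E \<union> image \<phi> ` E'" ?T R
      using drawn_stack by simp
    have abc: "a < m" "b < m" "c < m" "{a, b, c} \<subseteq> {..<m}" "card {a, b, c} = 3" using wf drawn_stack.hyps(2) by auto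
    have f: "{\<phi> a, \<phi> b, \<phi> c} \<in> ?T"
      using imageI[OF drawn_stack.hyps(2), of "image \<phi>"] by (simp only: image_insert image_empty UnI2)
    have pos3: "pos' (\<phi> a) = A a" "pos' (\<phi> b) = A b" "pos' (\<phi> c) = A c" "pos' (\<phi> m) = A m"
      using pA abc mn by auto
    have "\<not> collinear {A a, A b, A c}" using H.face_props(1)[OF f] pos3 by simp
    from encloses_interior[OF A_def drawn_stack.hyps(3) this]
    have i: "pos' (\<phi> m) \<in> interior (hull_of pos' {\<phi> a, \<phi> b, \<phi> c})" using pos3 by simp
    have m3: "3 \<le> m" using wf by (rule conjunct1)
    have ne: "\<phi> m \<noteq> \<phi> i" if "i < m" for i using injp[of m i] that mn by simp
    then have "\<phi> m \<notin> \<phi> ` {3..<m}" by (metis imageE atLeastLessThan_iff)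
    then have x: "\<phi> m \<notin> V \<union> \<phi> ` {3..<m}" using fresh[OF m3 mn] by blast
    from H.stack[OF f x i]
    have *: "triangulated pos' (insert (\<phi> m) (V \<union> \<phi> ` {3..<m}))
      (E \<union> image \<phi> ` E' \<union> {{\<phi> m, \<phi> a}, {\<phi> m, \<phi> b}, {\<phi> m, \<phi> c}})
      (?T - {{\<phi> a, \<phi> b, \<phi> c}} \<union> {{\<phi> a, \<phi> b, \<phi> m}, {\<phi> b, \<phi> c, \<phi> m}, {\<phi> a, \<phi> c, \<phi> m}}) R" .
    have vs: "insert (\<phi> m) (V \<union> \<phi> ` {3..<m}) = V \<union> \<phi> ` {3..<Suc m}"
      using m3 by (simp add: atLeastLessThanSuc)
    have es: "E \<union> image \<phi> ` E' \<union> {{\<phi> m, \<phi> a}, {\<phi> m, \<phi> b}, {\<phi> m, \<phi> c}} =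
        E \<union> image \<phi> ` (E' \<union> {{m, a}, {m, b}, {m, c}})" by (simp add: image_Un Un_assoc)
    have "\<phi> ` {a, b, c} \<notin> T - {?t0}" by (rule newT) (use abc mn in auto)
    moreover have "image \<phi> ` (T' - {{a, b, c}}) = image \<phi> ` T' - {\<phi> ` {a, b, c}}"
      by (rule image_Diff_single[of _ "{..<m}"])
         (use inj_on_subset[OF inj, of "{..<m}"] mn conjunct2[OF conjunct2[OF wf]] abc in auto)
    ultimately have ts: "?T - {{\<phi> a, \<phi> b, \<phi> c}} \<union> {{\<phi> a, \<phi> b, \<phi> m}, {\<phi> b, \<phi> c, \<phi> m}, {\<phi> a, \<phi> c, \<phi> m}} =
        T - {?t0} \<union> image \<phi> ` (T' - {{a, b, c}} \<union> {{a, b, m}, {b, c, m}, {a, c, m}})"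
      by (simp add: image_Un Un_assoc Un_Diff)
    show ?case using * unfolding vs es ts .
  next
    case (drawn_flip m E' T' a b c d)
    note wf = drawn_wf[OF drawn_flip.hyps(1)]
    let ?T = "T - {?t0} \<union> image \<phi> ` T'"
    have mn: "m \<le> n" using drawn_flip.prems by simp
    interpret H: triangulated pos' "V \<union> \<phi> ` {3..<m}" "E \<union> image \<phi> ` E'" ?T R
      using drawn_flip by simp
    have abc: "a < m" "b < m" "c < m" "d < m" "card {a, b, c} = 3" "card {d, b, c} = 3"
      using wf drawn_flip.hyps(2,3) by auto
    have f: "{\<phi> a, \<phi> b, \<phi> c} \<in> ?T" "{\<phi> d, \<phi> b, \<phi> c} \<in> ?T"
      using imageI[OF drawn_flip.hyps(2), of "image \<phi>"] imageI[OF drawn_flip.hyps(3), of "image \<phi>"]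
      by (simp_all only: image_insert image_empty UnI2)
    have pos4: "pos' (\<phi> a) = A a" "pos' (\<phi> b) = A b" "pos' (\<phi> c) = A c" "pos' (\<phi> d) = A d"
      using pA abc mn by auto
    have "a \<noteq> d" using drawn_flip.hyps(4) by (auto simp: crossing_def orient_def)
    then have "\<phi> a \<noteq> \<phi> d" using injp abc mn by auto
    then have "pos' (\<phi> a) \<noteq> pos' (\<phi> d)"
      using inj_onD[OF H.inj] H.face_props(8)[OF f(1)] H.face_props(8)[OF f(2)] by blast
    moreover have "pos' (\<phi> b) \<noteq> pos' (\<phi> c)" using H.face_props(1)[OF f(1)] by auto
    ultimately obtain P where P: "P \<in> open_segment (pos' (\<phi> b)) (pos' (\<phi> c))"
      "P \<in> open_segment (pos' (\<phi> a)) (pos' (\<phi> d))"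
      using crossing_segments[OF A_def drawn_flip.hyps(4)] pos4 by auto
    have "b < n" "c < n" using abc mn by auto
    then have "\<phi> b \<notin> V \<or> \<phi> c \<notin> V" using fresh[of b] fresh[of c] drawn_flip.hyps(5) by blast
    then obtain z where z: "z \<in> {b, c}" "\<phi> z \<notin> V" by blast
    have R: "\<not> {\<phi> b, \<phi> c} \<subseteq> R" using G.rim_subset z by auto
    have uniq: "t \<in> {{\<phi> a, \<phi> b, \<phi> c}, {\<phi> d, \<phi> b, \<phi> c}}" if t: "t \<in> ?T" "{\<phi> b, \<phi> c} \<subseteq> t" for t
    proof -
      have "t \<notin> T - {?t0}" using t(2) z G.face_subset[of t] by auto
      then have "t \<in> image \<phi> ` T'" using t(1) by (metis UnE)
      then obtain s where s: "s \<in> T'" "t = \<phi> ` s" by (rule imageE)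
      have sm: "s \<subseteq> {..<m}" using wf s(1) by blast
      have sn: "s \<subseteq> {..<n}" using sm mn by auto
      have "b \<in> s" "c \<in> s"
        using t(2) inj_on_image_mem_iff[OF inj _ sn] \<open>b < n\<close> \<open>c < n\<close> unfolding s(2) by simp_all
      then have "s = {a, b, c} \<or> s = {d, b, c}" using drawn_flip.hyps(6) s(1) by blast
      then show ?thesis using s(2) by auto
    qed
    from H.flip[OF f P uniq R]
    have *: "triangulated pos' (V \<union> \<phi> ` {3..<m}) (E \<union> image \<phi> ` E' - {{\<phi> b, \<phi> c}} \<union> {{\<phi> a, \<phi> d}})
      (?T - {{\<phi> a, \<phi> b, \<phi> c}, {\<phi> d, \<phi> b, \<phi> c}} \<union> {{\<phi> a, \<phi> b, \<phi> d}, {\<phi> a, \<phi> c, \<phi> d}}) R" .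
    have injm: "inj_on \<phi> {..<m}" using inj mn by (auto intro: inj_on_subset)
    have "\<phi> ` {b, c} \<notin> E" using newE abc mn drawn_flip.hyps(5) by simp
    moreover have "image \<phi> ` (E' - {{b, c}}) = image \<phi> ` E' - {\<phi> ` {b, c}}"
      by (rule image_Diff_single[OF injm]) (use conjunct1[OF conjunct2[OF wf]] abc in auto)
    ultimately have es: "E \<union> image \<phi> ` E' - {{\<phi> b, \<phi> c}} \<union> {{\<phi> a, \<phi> d}} =
        E \<union> image \<phi> ` (E' - {{b, c}} \<union> {{a, d}})" by (simp add: image_Un Un_assoc Un_Diff)
    have "\<phi> ` {a, b, c} \<notin> T - {?t0}" "\<phi> ` {d, b, c} \<notin> T - {?t0}"
      by (rule newT; use abc mn in auto)+
    note rem = two_removed[OF this, of "image \<phi> ` T'"]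
    have i1: "image \<phi> ` (T' - {{a, b, c}}) = image \<phi> ` T' - {\<phi> ` {a, b, c}}"
      by (rule image_Diff_single[OF injm]) (use conjunct2[OF conjunct2[OF wf]] abc in auto)
    have i2: "image \<phi> ` (T' - {{a, b, c}} - {{d, b, c}}) = image \<phi> ` (T' - {{a, b, c}}) - {\<phi> ` {d, b, c}}"
      by (rule image_Diff_single[OF injm]) (use conjunct2[OF conjunct2[OF wf]] abc in auto)
    have T2: "T' - {{a, b, c}, {d, b, c}} = T' - {{a, b, c}} - {{d, b, c}}" by (rule set_eqI) simp
    have "?T - {\<phi> ` {a, b, c}, \<phi> ` {d, b, c}} = T - {?t0} \<union> image \<phi> ` (T' - {{a, b, c}, {d, b, c}})"
      unfolding T2 i2 i1 rem ..
    then have ts: "?T - {{\<phi> a, \<phi> b, \<phi> c}, {\<phi> d, \<phi> b, \<phi> c}} \<union> {{\<phi> a, \<phi> b, \<phi> d}, {\<phi> a, \<phi> c, \<phi> d}} =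
        T - {?t0} \<union> image \<phi> ` (T' - {{a, b, c}, {d, b, c}} \<union> {{a, b, d}, {a, c, d}})"
      by (simp only: image_Un Un_assoc image_insert image_empty)
    show ?case using * unfolding es ts .
  qed
  from this[OF dr] show ?thesis by blast
qed

section \<open>Checking drawings by evaluation\<close>

text \<open>\<open>Stack a b c\<close> puts the next vertex into the face \<open>abc\<close>; \<open>Flip a b c d\<close> replaces the
diagonal \<open>bc\<close> of the quadrilateral \<open>a b d c\<close> by \<open>ad\<close>. Lists represent sets here, so that the moves
can be executed.\<close>

datatype drawing_step = Stack nat nat nat | Flip nat nat nat nat

fun run :: "(nat \<Rightarrow> int) \<Rightarrow> (nat \<Rightarrow> int) \<Rightarrow> drawing_step list \<Rightarrow>
    nat \<times> nat list list \<times> nat list list \<Rightarrow> (nat \<times> nat list list \<times> nat list list) option" where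
  "run X Y [] s = Some s"
| "run X Y (Stack a b c # ops) (n, E, T) =
    (if list_ex (\<lambda>t. set t = {a, b, c}) T \<and> encloses X Y a b c n
     then run X Y ops (Suc n, [n, a] # [n, b] # [n, c] # E,
       [a, b, n] # [b, c, n] # [a, c, n] # filter (\<lambda>t. set t \<noteq> {a, b, c}) T)
     else None)"
| "run X Y (Flip a b c d # ops) (n, E, T) =
    (if list_ex (\<lambda>t. set t = {a, b, c}) T \<and> list_ex (\<lambda>t. set t = {d, b, c}) T \<and>
        crossing X Y a d b c \<and> (3 \<le> b \<or> 3 \<le> c) \<and>
        list_all (\<lambda>t. b \<in> set t \<and> c \<in> set t \<longrightarrow> set t = {a, b, c} \<or> set t = {d, b, c}) T
     then run X Y ops (n, [a, d] # filter (\<lambda>e. set e \<noteq> {b, c}) E,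
       [a, b, d] # [a, c, d] # filter (\<lambda>t. set t \<noteq> {a, b, c} \<and> set t \<noteq> {d, b, c}) T)
     else None)"

lemma run_drawn:
  "run X Y ops s = Some (n', E', T') \<Longrightarrow> s = (n, E, T) \<Longrightarrow> drawn X Y n (set ` set E) (set ` set T) \<Longrightarrow>
     drawn X Y n' (set ` set E') (set ` set T')"
proof (induction X Y ops s arbitrary: n E T rule: run.induct)
  case (2 X Y a b c ops n0 E0 T0)
  have c: "list_ex (\<lambda>t. set t = {a, b, c}) T" "encloses X Y a b c n"
    using 2(2,3) by (auto split: if_splits)
  have t: "{a, b, c} \<in> set ` set T" using c(1) by (auto simp: list_ex_iff)
  have "set ` set (filter (\<lambda>t. set t \<noteq> {a, b, c}) T) = set ` set T - {{a, b, c}}" by auto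
  then have "drawn X Y (Suc n) (set ` set ([n, a] # [n, b] # [n, c] # E))
     (set ` set ([a, b, n] # [b, c, n] # [a, c, n] # filter (\<lambda>t. set t \<noteq> {a, b, c}) T))"
    using drawn_stack[OF 2(4) t c(2)] by (simp add: Un_commute)
  then show ?case using 2(1)[OF _ _ refl] 2(2,3) c by simp
next
  case (3 X Y a b c d ops n0 E0 T0)
  have c: "list_ex (\<lambda>t. set t = {a, b, c}) T" "list_ex (\<lambda>t. set t = {d, b, c}) T"
    "crossing X Y a d b c" "3 \<le> b \<or> 3 \<le> c"
    "list_all (\<lambda>t. b \<in> set t \<and> c \<in> set t \<longrightarrow> set t = {a, b, c} \<or> set t = {d, b, c}) T"
    using 3(2,3) by (auto split: if_splits)
  have t: "{a, b, c} \<in> set ` set T" "{d, b, c} \<in> set ` set T"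
    using c(1,2) by (auto simp: list_ex_iff)
  have u: "\<forall>t\<in>set ` set T. b \<in> t \<and> c \<in> t \<longrightarrow> t = {a, b, c} \<or> t = {d, b, c}"
    using c(5) by (auto simp: list_all_iff)
  have "set ` set (filter (\<lambda>t. set t \<noteq> {a, b, c} \<and> set t \<noteq> {d, b, c}) T) = set ` set T - {{a, b, c}, {d, b, c}}"
    "set ` set (filter (\<lambda>e. set e \<noteq> {b, c}) E) = set ` set E - {{b, c}}" by auto
  then have "drawn X Y n (set ` set ([a, d] # filter (\<lambda>e. set e \<noteq> {b, c}) E))
     (set ` set ([a, b, d] # [a, c, d] # filter (\<lambda>t. set t \<noteq> {a, b, c} \<and> set t \<noteq> {d, b, c}) T))"
    using drawn_flip[OF 3(4) t c(3,4) u] by (simp add: Un_commute)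
  then show ?case using 3(1)[OF _ _ refl] 3(2,3) c by simp
qed simp

definition draws :: "(int \<times> int) list \<Rightarrow> drawing_step list \<Rightarrow> nat \<Rightarrow> (nat \<times> nat) list \<Rightarrow> nat list list \<Rightarrow> bool" where
  "draws ps ops n es ts \<longleftrightarrow>
     (case run (\<lambda>i. fst (ps ! i)) (\<lambda>i. snd (ps ! i)) ops (3, [[0, 1], [0, 2], [1, 2]], [[0, 1, 2]]) of
        None \<Rightarrow> False
      | Some (m, E, T) \<Rightarrow> m = n \<and> list_all (\<lambda>(u, v). list_ex (\<lambda>e. set e = {u, v}) E) es \<and>
          list_all (\<lambda>s. list_ex (\<lambda>t. set t = set s) T) ts)"

lemma draws_drawn:
  assumes "draws ps ops n es ts"
  obtains E T where "drawn (\<lambda>i. fst (ps ! i)) (\<lambda>i. snd (ps ! i)) n E T"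
    "\<And>u v. (u, v) \<in> set es \<Longrightarrow> {u, v} \<in> E" "\<And>t. t \<in> set ts \<Longrightarrow> set t \<in> T"
proof -
  let ?X = "\<lambda>i. fst (ps ! i)" and ?Y = "\<lambda>i. snd (ps ! i)"
  obtain E T where r: "run ?X ?Y ops (3, [[0, 1], [0, 2], [1, 2]], [[0, 1, 2]]) = Some (n, E, T)"
    and e: "list_all (\<lambda>(u, v). list_ex (\<lambda>e. set e = {u, v}) E) es"
    and t: "list_all (\<lambda>s. list_ex (\<lambda>t. set t = set s) T) ts"
    using assms unfolding draws_def by (auto split: option.splits)
  have "drawn ?X ?Y n (set ` set E) (set ` set T)"
    by (rule run_drawn[OF r refl]) (use drawn_init in simp)
  moreover have "{u, v} \<in> set ` set E" if uv: "(u, v) \<in> set es" for u v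
  proof -
    have "list_ex (\<lambda>e. set e = {u, v}) E" using e uv by (auto simp: list_all_iff)
    then obtain x where "x \<in> set E" "set x = {u, v}" unfolding list_ex_iff by blast
    then show ?thesis by (metis imageI)
  qed
  moreover have "set s \<in> set ` set T" if sts: "s \<in> set ts" for s
  proof -
    have "list_ex (\<lambda>t. set t = set s) T" using t sts by (auto simp: list_all_iff)
    then obtain x where "x \<in> set T" "set x = set s" unfolding list_ex_iff by blast
    then show ?thesis by (metis imageI)
  qed
  ultimately show ?thesis using that by blast
qed

text \<open>The points come from a rounded barycentric embedding of the block with the corner 2 added. The
steps were found backwards: a vertex of least degree is removed and the hole triangulated, and
reinserting it takes one stack and a flip for every neighbour beyond the third.\<close>

definition block_points :: "(int \<times> int) list" where
  "block_points = [
    (0,0), (45,0), (0,45), (17,16), (25,8), (16,9), (28,5), (29,7), (20,10), (20,9), (23,7),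
    (21,11), (21,10), (21,9), (22,8), (22,9), (22,10), (23,9)
  ]"

definition block_steps :: "drawing_step list" where
  "block_steps = [
    Stack 0 1 2, Stack 0 1 3, Stack 0 3 4, Stack 0 1 4, Flip 6 0 4 5, Stack 1 3 4, Flip 7 1 4 6,
    Stack 3 4 5, Stack 4 5 8, Stack 4 5 6, Flip 10 4 5 9, Stack 3 4 8, Flip 11 3 4 7,
    Stack 4 8 11, Stack 4 8 9, Flip 13 4 8 12, Stack 4 9 10, Flip 14 4 9 13, Stack 4 12 13,
    Flip 15 4 13 14, Stack 4 11 12, Flip 16 4 12 15, Stack 4 15 16, Flip 17 4 15 14,
    Flip 17 4 14 10
  ]"

lemma block_draws: "draws block_points block_steps 18 block_edges []"
  by code_simp

text \<open>The frame: 0, 1, 2 are the triangle, 3 is the centre, and 6, 4, 5 are attached to 0, 1, 2 as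
the other ends of the distinguished edges. The three listed faces receive the blocks.\<close>

definition frame_points :: "(int \<times> int) list" where
  "frame_points = [(0,0), (27,0), (0,27), (9,9), (12,3), (12,12), (3,12)]"

definition frame_steps :: "drawing_step list" where
  "frame_steps = [Stack 0 1 2, Stack 0 1 3, Stack 1 2 3, Stack 0 2 3]"

definition frame_edges :: "(nat \<times> nat) list" where
  "frame_edges = [(3,0), (3,1), (3,2), (3,4), (3,5), (3,6), (4,1), (5,2), (6,0), (0,1), (1,2), (2,0),
     (0,4), (1,5), (2,6)]"

lemma frame_draws: "draws frame_points frame_steps 7 frame_edges [[4,1,3], [5,2,3], [6,0,3]]"
  by code_simp

text \<open>Three nested new vertices produce a face with only new corners, the outer triangle of
the next copy.\<close>

lemma collar_draws:
  "draws [(0,0), (27,0), (0,27), (9,9), (12,3), (16,4)] [Stack 0 1 2, Stack 0 1 3, Stack 1 3 4] 6 [] [[3,4,5]]"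
  by code_simp

lemma insert_fresh:
  fixes V :: "nat set"
  assumes tr: "triangulated pos V E T R" and t: "{p, q, r} \<in> T"
    and d: "draws ps ops n es ts" and pts: "take 3 ps = [(0, 0), (N, 0), (0, N)]" "N \<noteq> 0" "3 \<le> length ps"
  obtains pos' \<phi> E' T' where "triangulated pos' (V \<union> \<phi> ` {3..<n}) E' T' R"
    "\<phi> 0 = p" "\<phi> 1 = q" "\<phi> 2 = r" "inj_on \<phi> {..<n}" "\<phi> ` {3..<n} \<inter> V = {}"
    "E \<subseteq> E'" "T - {{p, q, r}} \<subseteq> T'"
    "\<And>u v. (u, v) \<in> set es \<Longrightarrow> {\<phi> u, \<phi> v} \<in> E'" "\<And>t. t \<in> set ts \<Longrightarrow> \<phi> ` set t \<in> T'"
proof -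
  interpret triangulated pos V E T R by (rule tr)
  define \<phi> where "\<phi> = (\<lambda>i. if i = 0 then p else if i = 1 then q else if i = 2 then r else Suc (Max V) + i)"
  obtain El Tl where dr: "drawn (\<lambda>i. fst (ps ! i)) (\<lambda>i. snd (ps ! i)) n El Tl"
    and es: "\<And>u v. (u, v) \<in> set es \<Longrightarrow> {u, v} \<in> El" and ts: "\<And>t. t \<in> set ts \<Longrightarrow> set t \<in> Tl"
    using draws_drawn[OF d] by metis
  note fp = face_props[OF t]
  have big: "v \<le> Max V" if "v \<in> V" for v using finite_V that by simp
  have fresh: "\<phi> i \<notin> V" if "3 \<le> i" for i using big[of "\<phi> i"] that by (auto simp: \<phi>_def)
  have inj: "inj_on \<phi> {..<n}"
    using fp big[OF fp(8)] big[OF fp(9)] big[OF fp(10)] by (auto simp: inj_on_def \<phi>_def)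
  have nth: "ps ! i = [(0, 0), (N, 0), (0, N)] ! i" if "i < 3" for i
    using pts(1) that nth_take[of i 3 ps] by metis
  have t': "{\<phi> 0, \<phi> 1, \<phi> 2} \<in> T" using t by (simp add: \<phi>_def)
  obtain pos' where p: "triangulated pos' (V \<union> \<phi> ` {3..<n}) (E \<union> image \<phi> ` El)
      (T - {{\<phi> 0, \<phi> 1, \<phi> 2}} \<union> image \<phi> ` Tl) R"
    using insert_drawn[OF tr dr t' inj fresh _ _ _ _ _ _ pts(2)] nth[of 0] nth[of 1] nth[of 2] by auto
  show ?thesis
  proof (rule that[OF p])
    show "\<phi> 0 = p" "\<phi> 1 = q" "\<phi> 2 = r" by (simp_all add: \<phi>_def)
    then show "T - {{p, q, r}} \<subseteq> T - {{\<phi> 0, \<phi> 1, \<phi> 2}} \<union> image \<phi> ` Tl" by (simp only: Un_upper1)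
    show "inj_on \<phi> {..<n}" by (rule inj)
    show "\<phi> ` {3..<n} \<inter> V = {}" using fresh by auto
    show "E \<subseteq> E \<union> image \<phi> ` El" by (rule Un_upper1)
    show "{\<phi> u, \<phi> v} \<in> E \<union> image \<phi> ` El" if "(u, v) \<in> set es" for u v
      using imageI[OF es[OF that], of "image \<phi>"] by (simp only: image_insert image_empty UnI2)
    show "\<phi> ` set t \<in> T - {{\<phi> 0, \<phi> 1, \<phi> 2}} \<union> image \<phi> ` Tl" if "t \<in> set ts" for t
      using imageI[OF ts[OF that], of "image \<phi>"] by (simp only: UnI2)
  qed
qed

section \<open>Forests in the block\<close>

definition acyclic_on :: "'a set set \<Rightarrow> 'a set \<Rightarrow> bool" where
  "acyclic_on E F \<longleftrightarrow> (\<nexists>p. 3 \<le> length p \<and> distinct p \<and> set p \<subseteq> F \<and>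
     (\<forall>i<length p. {p ! i, p ! (Suc i mod length p)} \<in> E))"

lemma acyclic_on_subset: "acyclic_on E' F \<Longrightarrow> E \<subseteq> E' \<Longrightarrow> acyclic_on E F"
  unfolding acyclic_on_def by (meson subsetD)

lemma acyclic_on_mono: "acyclic_on E F \<Longrightarrow> F' \<subseteq> F \<Longrightarrow> acyclic_on E F'"
  unfolding acyclic_on_def by (meson subset_trans)

lemma forest_acyclic_on:
  assumes "forest (induced (V, E) F)"
  shows "acyclic_on E F"
  unfolding acyclic_on_def
proof
  assume "\<exists>p. 3 \<le> length p \<and> distinct p \<and> set p \<subseteq> F \<and> (\<forall>i<length p. {p ! i, p ! (Suc i mod length p)} \<in> E)"
  then obtain p where p: "3 \<le> length p" "distinct p" "set p \<subseteq> F"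
    "\<And>i. i < length p \<Longrightarrow> {p ! i, p ! (Suc i mod length p)} \<in> E" by blast
  have "p ! i \<in> F \<and> p ! (Suc i mod length p) \<in> F" if "i < length p" for i
    using p(3) that nth_mem by (metis gr_implies_not0 mod_less_divisor neq0_conv subsetD)
  then have "is_cycle (induced (V, E) F) p"
    using p by (simp add: is_cycle_def induced_def)
  then show False using assms by (auto simp: forest_def)
qed

lemma acyclic_on_triangle:
  assumes "acyclic_on E F" "{a, b} \<in> E" "{b, c} \<in> E" "{c, a} \<in> E" "a \<noteq> b" "b \<noteq> c" "a \<noteq> c"
  shows "\<not> {a, b, c} \<subseteq> F"
proof
  assume F: "{a, b, c} \<subseteq> F"
  have "{[a, b, c] ! i, [a, b, c] ! (Suc i mod length [a, b, c])} \<in> E" if "i < length [a, b, c]" for i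
  proof -
    have "i = 0 \<or> i = 1 \<or> i = 2" using that by auto
    then show ?thesis using assms(2-4) by (elim disjE) simp_all
  qed
  then have "3 \<le> length [a, b, c] \<and> distinct [a, b, c] \<and> set [a, b, c] \<subseteq> F \<and>
      (\<forall>i<length [a, b, c]. {[a, b, c] ! i, [a, b, c] ! (Suc i mod length [a, b, c])} \<in> E)"
    using assms(5-7) F by (intro conjI allI impI) simp_all
  then have "\<not> acyclic_on E F" unfolding acyclic_on_def not_not by (rule exI[where x = "[a, b, c]"])
  then show False using assms(1) by simp
qed

lemma cycle_in_image:
  assumes "cycle_in es c" "\<And>u v. (u, v) \<in> set es \<Longrightarrow> {\<phi> u, \<phi> v} \<in> E" "inj_on \<phi> (set c)" "acyclic_on E F"
  shows "\<not> \<phi> ` set c \<subseteq> F"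
proof
  assume F: "\<phi> ` set c \<subseteq> F"
  have c: "3 \<le> length c" "distinct c"
    "list_all (\<lambda>(u, v). (u, v) \<in> set es \<or> (v, u) \<in> set es) (zip c (rotate1 c))"
    using assms(1) by (auto simp: cycle_in_def)
  have "{map \<phi> c ! i, map \<phi> c ! (Suc i mod length (map \<phi> c))} \<in> E" if i: "i < length (map \<phi> c)" for i
  proof -
    have i': "i < length c" using i by simp
    have "(c ! i, rotate1 c ! i) \<in> set (zip c (rotate1 c))"
      using i' by (auto simp: set_zip)
    then have "(c ! i, c ! (Suc i mod length c)) \<in> set es \<or> (c ! (Suc i mod length c), c ! i) \<in> set es"
      using c(3) nth_rotate1[OF i'] by (auto simp: list_all_iff)
    moreover have "Suc i mod length c < length c" using i' by (intro mod_less_divisor) linarith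
    moreover have "{\<phi> (c ! i), \<phi> (c ! (Suc i mod length c))} \<in> E"
      using calculation(1) assms(2) by (metis insert_commute)
    ultimately show ?thesis using i' by simp
  qed
  then have "3 \<le> length (map \<phi> c) \<and> distinct (map \<phi> c) \<and> set (map \<phi> c) \<subseteq> F \<and>
      (\<forall>i<length (map \<phi> c). {map \<phi> c ! i, map \<phi> c ! (Suc i mod length (map \<phi> c))} \<in> E)"
    using c F assms(3) by (intro conjI allI impI) (simp_all add: distinct_map)
  then have "\<not> acyclic_on E F" unfolding acyclic_on_def not_not by (rule exI[where x = "map \<phi> c"])
  then show False using assms(4) by simp
qed

definition block_verts :: "nat set" where "block_verts = {0, 1} \<union> {3..<18}"

text \<open>The block vertices outside the forest hit every listed cycle and the distinguished edge, so there are at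
least 9 of them among 17.\<close>

lemma block_bound:
  assumes inj: "inj_on \<phi> {..<18}" and E: "\<And>u v. (u, v) \<in> set block_edges \<Longrightarrow> {\<phi> u, \<phi> v} \<in> E"
    and F: "acyclic_on E F" and ne: "\<not> {\<phi> 0, \<phi> 1} \<subseteq> F"
  shows "card (F \<inter> \<phi> ` block_verts) \<le> 8"
proof -
  have P: "block_verts \<subseteq> {..<18}" "finite block_verts" "card block_verts = 17"
    by (auto simp: block_verts_def card_Un_disjoint)
  define X where "X = {i \<in> block_verts. \<phi> i \<notin> F}"
  have "hits X ([1, 0] # block_cycles)"
    unfolding hits_def
  proof
    fix c assume "c \<in> set ([1, 0] # block_cycles)"
    then consider "c = [1, 0]" | "c \<in> set block_cycles" by auto
    then show "set c \<inter> X \<noteq> {}"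
    proof cases
      case 1 then show ?thesis using ne by (auto simp: X_def block_verts_def)
    next
      case 2
      have cyc: "cycle_in block_edges c" using block_cycles 2 by (simp add: list_all_iff)
      have "x < 18 \<and> x \<noteq> 2" if "x \<in> set c" for x
        using block_cycles_range 2 that by (simp add: list_all_iff)
      then have sub: "set c \<subseteq> block_verts" by (fastforce simp: block_verts_def)
      then have "inj_on \<phi> (set c)" using inj_on_subset[OF inj] P(1) by blast
      from cycle_in_image[OF cyc E this F] show ?thesis using sub by (auto simp: X_def)
    qed
  qed
  moreover have "finite X" using P(2) by (simp add: X_def)
  ultimately have "8 < card X" using unhittable_card[OF block_unhittable] by blast
  moreover have "F \<inter> \<phi> ` block_verts = \<phi> ` (block_verts - X)" by (auto simp: X_def)
  then have "card (F \<inter> \<phi> ` block_verts) = card (block_verts - X)"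
    using card_image inj_on_subset[OF inj] P(1) by (metis Diff_subset subset_trans)
  moreover have "card (block_verts - X) = card block_verts - card X"
    by (rule card_Diff_subset) (use P(2) in \<open>auto simp: X_def\<close>)
  ultimately show ?thesis using P(3) by linarith
qed

text \<open>The bound is stated for every larger edge set, because later insertions keep adding edges
before it is used. A forest through both ends loses only \<open>a\<close> when it is reduced to the
first case.\<close>

lemma insert_block:
  fixes V :: "nat set"
  assumes tr: "triangulated pos V E T R" and t: "{a, b, y} \<in> T"
  obtains pos' W E' T' where "triangulated pos' (V \<union> W) E' T' R" "W \<inter> V = {}" "card W = 15" "finite W"
    "E \<subseteq> E'" "T - {{a, b, y}} \<subseteq> T'"
    "\<And>E'' F. E' \<subseteq> E'' \<Longrightarrow> acyclic_on E'' F \<Longrightarrow>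
       card (F \<inter> (W \<union> {a, b})) \<le> 8 + (if a \<in> F \<and> b \<in> F then 1 else 0)"
proof -
  have rim: "take 3 block_points = [(0, 0), (45, 0), (0, 45)]" "3 \<le> length block_points"
    by (simp_all add: block_points_def)
  obtain pos' \<phi> E' T' where *: "triangulated pos' (V \<union> \<phi> ` {3..<18}) E' T' R"
    "\<phi> 0 = a" "\<phi> 1 = b" "\<phi> 2 = y" "inj_on \<phi> {..<18}" "\<phi> ` {3..<18} \<inter> V = {}"
    "E \<subseteq> E'" "T - {{a, b, y}} \<subseteq> T'"
    "\<And>u v. (u, v) \<in> set block_edges \<Longrightarrow> {\<phi> u, \<phi> v} \<in> E'"
    using insert_fresh[OF tr t block_draws rim(1) _ rim(2)] by (metis zero_neq_numeral)
  let ?W = "\<phi> ` {3..<18}"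
  have "inj_on \<phi> {3..<18}" by (rule inj_on_subset[OF *(5)]) auto
  then have W: "card ?W = 15" "finite ?W" by (simp_all add: card_image)
  have blk: "?W \<union> {a, b} = \<phi> ` block_verts" using *(2,3) by (auto simp: block_verts_def)
  show ?thesis
  proof (rule that[OF *(1,6) W *(7,8)])
    fix E'' F assume E'': "E' \<subseteq> E''" and F: "acyclic_on E'' F"
    have e: "{\<phi> u, \<phi> v} \<in> E''" if "(u, v) \<in> set block_edges" for u v using *(9)[OF that] E'' by blast
    show "card (F \<inter> (?W \<union> {a, b})) \<le> 8 + (if a \<in> F \<and> b \<in> F then 1 else 0)"
    proof (cases "a \<in> F \<and> b \<in> F")
      case False
      then show ?thesis using block_bound[OF *(5) e F] *(2,3) unfolding blk by auto
    next
      case True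
      have F': "acyclic_on E'' (F - {a})" using acyclic_on_mono[OF F] by blast
      have "card ((F - {a}) \<inter> (?W \<union> {a, b})) \<le> 8"
        unfolding blk by (rule block_bound[OF *(5) e F']) (use *(2) in auto)
      moreover have "F \<inter> (?W \<union> {a, b}) \<subseteq> insert a ((F - {a}) \<inter> (?W \<union> {a, b}))" by blast
      then have "card (F \<inter> (?W \<union> {a, b})) \<le> card (insert a ((F - {a}) \<inter> (?W \<union> {a, b})))"
        by (rule card_mono[rotated]) (use W in auto)
      ultimately show ?thesis using True by (simp add: card_insert_if)
    qed
  qed
qed

section \<open>The graphs on \<open>52 * k\<close> vertices\<close>

lemma triangle_triangulated:
  fixes pos :: "'a \<Rightarrow> complex"
  assumes nc: "\<not> collinear {pos a, pos b, pos c}" and d: "a \<noteq> b" "b \<noteq> c" "a \<noteq> c"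
  shows "triangulated pos {a, b, c} {{a, b}, {b, c}, {a, c}} {{a, b, c}} {a, b, c}"
proof -
  have nc2: "\<not> collinear {pos b, pos c, pos a}" "\<not> collinear {pos b, pos a, pos c}"
     "\<not> collinear {pos a, pos c, pos b}" "\<not> collinear {pos c, pos a, pos b}" "\<not> collinear {pos c, pos b, pos a}"
    using nc by (simp_all add: insert_commute)
  have dp: "pos a \<noteq> pos b" "pos b \<noteq> pos c" "pos a \<noteq> pos c" using nc nc2 by auto
  have seg: "closed_segment (pos a) (pos b) \<inter> closed_segment (pos b) (pos c) = {pos b}"
    "closed_segment (pos b) (pos a) \<inter> closed_segment (pos a) (pos c) = {pos a}"
    "closed_segment (pos b) (pos c) \<inter> closed_segment (pos c) (pos a) = {pos c}"
    using Int_closed_segment nc nc2 by blast+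
  have out: "z \<notin> closed_segment x y" if "\<not> collinear {x, z, y}" for x y z :: complex
    using that between_imp_collinear[of x y z] by (auto simp: between_mem_segment insert_commute)
  have vs: "pos c \<notin> closed_segment (pos a) (pos b)" "pos a \<notin> closed_segment (pos b) (pos c)"
     "pos b \<notin> closed_segment (pos a) (pos c)"
    using out nc nc2 by blast+
  let ?I = "interior (convex hull {pos a, pos b, pos c})"
  have int: "?I \<inter> closed_segment (pos a) (pos b) = {}" "?I \<inter> closed_segment (pos b) (pos c) = {}"
     "?I \<inter> closed_segment (pos a) (pos c) = {}"
    by (auto simp: interior_of_triangle closed_segment_commute)
  have vi: "pos a \<notin> ?I" "pos b \<notin> ?I" "pos c \<notin> ?I" using int by auto
  have seg': "hull_of pos e \<inter> hull_of pos e' \<subseteq> pos ` (e \<inter> e')"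
    if "e \<in> {{a, b}, {b, c}, {a, c}}" "e' \<in> {{a, b}, {b, c}, {a, c}}" "e \<noteq> e'" for e e'
    using that d seg
    by (elim insertE emptyE) (simp_all add: closed_segment_commute Int_commute insert_commute)
  show ?thesis
  proof
    show "finite {a, b, c}" "inj_on pos {a, b, c}" using dp by auto
    show "e \<subseteq> {a, b, c} \<and> card e = 2" if "e \<in> {{a, b}, {b, c}, {a, c}}" for e
      using that d by auto
    show "v \<in> e" if "e \<in> {{a, b}, {b, c}, {a, c}}" "v \<in> {a, b, c}" "pos v \<in> hull_of pos e" for e v
      using that vs by (elim insertE emptyE) auto
    show "card t = 3 \<and> \<not> collinear (pos ` t) \<and> (\<forall>u\<in>t. \<forall>v\<in>t. u \<noteq> v \<longrightarrow> {u, v} \<in> {{a, b}, {b, c}, {a, c}})"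
      if "t \<in> {{a, b, c}}" for t using that d nc by auto
    show "interior (hull_of pos t) \<inter> hull_of pos e = {}"
      if "t \<in> {{a, b, c}}" "e \<in> {{a, b}, {b, c}, {a, c}}" for t e using that int by auto
    show "pos v \<notin> interior (hull_of pos t)" if "t \<in> {{a, b, c}}" "v \<in> {a, b, c}" for t v
      using that vi by auto
    show "pos v \<in> hull_of pos {a, b, c}" if "v \<in> {a, b, c}" for v
      using that unfolding hull_of_def by (intro hull_inc imageI)
    show "hull_of pos {a, b, c} = (\<Union>t\<in>{{a, b, c}}. hull_of pos t)" by simp
    show "{u, v} \<in> {{a, b}, {b, c}, {a, c}}" if "u \<in> {a, b, c}" "v \<in> {a, b, c}" "u \<noteq> v" for u v
      using that by auto
    show "\<not> collinear (pos ` {a, b, c})" using nc by simp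
  qed (use seg' d in auto)
qed

lemma insert_neq: "x \<notin> B \<Longrightarrow> insert x A \<noteq> B"
  by blast

lemma in_of_Diff: "x \<in> A \<Longrightarrow> x \<noteq> y \<Longrightarrow> A - {y} \<subseteq> B \<Longrightarrow> x \<in> B"
  by blast

text \<open>Writing \<open>mi\<close> for the number of distinguished edges in the forest at the \<open>i\<close>-th block, the count is
at most \<open>[v] + (8 + m1) + (8 + m2) + (8 + m3)\<close>, and the six triangles listed in the proof
exclude that two of the four extra terms are present. The corners \<open>p\<close>, \<open>q\<close>, \<open>r\<close>
belong to the copy, which therefore adds 49 vertices.\<close>

lemma insert_unit:
  fixes V :: "nat set"
  assumes tr: "triangulated pos V E T R" and t: "{p, q, r} \<in> T"
  obtains pos' V' E' T' where "triangulated pos' V' E' T' R" "V \<subseteq> V'" "card V' = card V + 49" "E \<subseteq> E'"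
    "\<And>E'' F. E' \<subseteq> E'' \<Longrightarrow> acyclic_on E'' F \<Longrightarrow> card (F \<inter> (V' - V \<union> {p, q, r})) \<le> 25"
proof -
  have rim: "take 3 frame_points = [(0, 0), (27, 0), (0, 27)]" "3 \<le> length frame_points"
    by (simp_all add: frame_points_def)
  obtain pos1 \<phi> E1 T1 where *: "triangulated pos1 (V \<union> \<phi> ` {3..<7}) E1 T1 R"
    "\<phi> 0 = p" "\<phi> 1 = q" "\<phi> 2 = r" "inj_on \<phi> {..<7}" "\<phi> ` {3..<7} \<inter> V = {}" "E \<subseteq> E1"
    "\<And>u v. (u, v) \<in> set frame_edges \<Longrightarrow> {\<phi> u, \<phi> v} \<in> E1"
    "\<And>t. t \<in> set [[4,1,3], [5,2,3], [6,0,3]] \<Longrightarrow> \<phi> ` set t \<in> T1"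
    using insert_fresh[OF tr t frame_draws rim(1) _ rim(2)] by (metis zero_neq_numeral)
  have ne: "\<phi> i \<noteq> \<phi> j" if "i < 7" "j < 7" "i \<noteq> j" for i j using inj_onD[OF *(5)] that by blast
  have T1: "{\<phi> 4, \<phi> 1, \<phi> 3} \<in> T1" "{\<phi> 5, \<phi> 2, \<phi> 3} \<in> T1" "{\<phi> 6, \<phi> 0, \<phi> 3} \<in> T1"
    using *(9)[of "[4,1,3]"] *(9)[of "[5,2,3]"] *(9)[of "[6,0,3]"] by simp_all
  define V1 where "V1 = V \<union> \<phi> ` {3..<7}"
  have tr1: "triangulated pos1 V1 E1 T1 R" using *(1) by (simp add: V1_def)
  obtain pos2 W1 E2 T2 where b1: "triangulated pos2 (V1 \<union> W1) E2 T2 R" "W1 \<inter> V1 = {}" "card W1 = 15" "finite W1"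
    "E1 \<subseteq> E2" "T1 - {{\<phi> 4, \<phi> 1, \<phi> 3}} \<subseteq> T2"
    "\<And>E'' F. E2 \<subseteq> E'' \<Longrightarrow> acyclic_on E'' F \<Longrightarrow>
       card (F \<inter> (W1 \<union> {\<phi> 4, \<phi> 1})) \<le> 8 + (if \<phi> 4 \<in> F \<and> \<phi> 1 \<in> F then 1 else 0)"
    using insert_block[OF tr1 T1(1)] by metis
  have "\<phi> 5 \<notin> {\<phi> 4, \<phi> 1, \<phi> 3}" "\<phi> 6 \<notin> {\<phi> 4, \<phi> 1, \<phi> 3}" "\<phi> 6 \<notin> {\<phi> 5, \<phi> 2, \<phi> 3}" using ne by simp_all
  note d = this[THEN insert_neq]
  have T2: "{\<phi> 5, \<phi> 2, \<phi> 3} \<in> T2" "{\<phi> 6, \<phi> 0, \<phi> 3} \<in> T2"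
    by (rule in_of_Diff[OF _ _ b1(6)], rule T1, rule d)+
  obtain pos3 W2 E3 T3 where b2: "triangulated pos3 (V1 \<union> W1 \<union> W2) E3 T3 R" "W2 \<inter> (V1 \<union> W1) = {}" "card W2 = 15" "finite W2"
    "E2 \<subseteq> E3" "T2 - {{\<phi> 5, \<phi> 2, \<phi> 3}} \<subseteq> T3"
    "\<And>E'' F. E3 \<subseteq> E'' \<Longrightarrow> acyclic_on E'' F \<Longrightarrow>
       card (F \<inter> (W2 \<union> {\<phi> 5, \<phi> 2})) \<le> 8 + (if \<phi> 5 \<in> F \<and> \<phi> 2 \<in> F then 1 else 0)"
    using insert_block[OF b1(1) T2(1)] by metis
  have T3: "{\<phi> 6, \<phi> 0, \<phi> 3} \<in> T3" by (rule in_of_Diff[OF T2(2) d(3) b2(6)])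
  obtain pos4 W3 E4 T4 where b3: "triangulated pos4 (V1 \<union> W1 \<union> W2 \<union> W3) E4 T4 R"
    "W3 \<inter> (V1 \<union> W1 \<union> W2) = {}" "card W3 = 15" "finite W3" "E3 \<subseteq> E4"
    "\<And>E'' F. E4 \<subseteq> E'' \<Longrightarrow> acyclic_on E'' F \<Longrightarrow>
       card (F \<inter> (W3 \<union> {\<phi> 6, \<phi> 0})) \<le> 8 + (if \<phi> 6 \<in> F \<and> \<phi> 0 \<in> F then 1 else 0)"
    using insert_block[OF b2(1) T3] by metis
  have finV: "finite V" using tr by (simp add: triangulated_def)
  have "inj_on \<phi> {3..<7}" by (rule inj_on_subset[OF *(5)]) auto
  then have c4: "card (\<phi> ` {3..<7}) = 4" by (simp add: card_image)
  have "card V1 = card V + 4" unfolding V1_def using c4 *(6) finV by (subst card_Un_disjoint) auto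
  moreover have "finite V1" using finV by (simp add: V1_def)
  ultimately have cV: "card (V1 \<union> W1 \<union> W2 \<union> W3) = card V + 49"
    using b1(2-4) b2(2-4) b3(2-4)
    by (simp add: card_Un_disjoint Int_commute[of _ W1] Int_commute[of _ W2] Int_commute[of _ W3])
  have E: "E1 \<subseteq> E4" "E2 \<subseteq> E4" "E3 \<subseteq> E4" using b1(5) b2(5) b3(5) by blast+
  show ?thesis
  proof (rule that[OF b3(1) _ cV])
    show "V \<subseteq> V1 \<union> W1 \<union> W2 \<union> W3" "E \<subseteq> E4" using E *(7) by (auto simp: V1_def)
    fix E'' F assume E'': "E4 \<subseteq> E''" and F: "acyclic_on E'' F"
    have e: "{\<phi> u, \<phi> v} \<in> E''" if "(u, v) \<in> set frame_edges" for u v using *(8)[OF that] E E'' by blast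
    have fe: "(u, v) \<in> set frame_edges \<longleftrightarrow> (u, v) \<in> {(3,0), (3,1), (3,2), (3,4), (3,5), (3,6), (4,1), (5,2), (6,0),
       (0,1), (1,2), (2,0), (0,4), (1,5), (2,6)}" for u v by (simp add: frame_edges_def)
    have tri: "\<not> {\<phi> i, \<phi> j, \<phi> k} \<subseteq> F"
      if "(i, j) \<in> set frame_edges" "(j, k) \<in> set frame_edges" "(k, i) \<in> set frame_edges \<or> (i, k) \<in> set frame_edges"
        "i < 7" "j < 7" "k < 7" "i \<noteq> j" "j \<noteq> k" "i \<noteq> k" for i j k
    proof -
      have "{\<phi> k, \<phi> i} \<in> E''" using e that(3) by (metis insert_commute)
      from acyclic_on_triangle[OF F e[OF that(1)] e[OF that(2)] this] show ?thesis using ne that by blast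
    qed
    \<comment> \<open>the centre with each distinguished edge, then each pair of distinguished edges\<close>
    have v: "\<not> {\<phi> 3, \<phi> 4, \<phi> 1} \<subseteq> F" "\<not> {\<phi> 3, \<phi> 5, \<phi> 2} \<subseteq> F" "\<not> {\<phi> 3, \<phi> 6, \<phi> 0} \<subseteq> F"
      "\<not> {\<phi> 0, \<phi> 4, \<phi> 1} \<subseteq> F" "\<not> {\<phi> 1, \<phi> 5, \<phi> 2} \<subseteq> F" "\<not> {\<phi> 2, \<phi> 6, \<phi> 0} \<subseteq> F"
      by (rule tri; simp add: fe)+
    have c1: "card (F \<inter> (W1 \<union> {\<phi> 4, \<phi> 1})) \<le> 8 + (if \<phi> 4 \<in> F \<and> \<phi> 1 \<in> F then 1 else 0)"
      by (rule b1(7)[OF _ F]) (use E E'' in blast)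
    have c2: "card (F \<inter> (W2 \<union> {\<phi> 5, \<phi> 2})) \<le> 8 + (if \<phi> 5 \<in> F \<and> \<phi> 2 \<in> F then 1 else 0)"
      by (rule b2(7)[OF _ F]) (use E E'' in blast)
    have c3: "card (F \<inter> (W3 \<union> {\<phi> 6, \<phi> 0})) \<le> 8 + (if \<phi> 6 \<in> F \<and> \<phi> 0 \<in> F then 1 else 0)"
      by (rule b3(6)[OF _ F]) (use E'' in blast)
    have i7: "{3..<7} = {3, 4, 5, 6::nat}" by auto
    let ?A = "F \<inter> {\<phi> 3}" and ?B = "F \<inter> (W1 \<union> {\<phi> 4, \<phi> 1})" and ?C = "F \<inter> (W2 \<union> {\<phi> 5, \<phi> 2})"
      and ?D = "F \<inter> (W3 \<union> {\<phi> 6, \<phi> 0})"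
    have "F \<inter> ((V1 \<union> W1 \<union> W2 \<union> W3) - V \<union> {p, q, r}) \<subseteq> ?A \<union> ?B \<union> ?C \<union> ?D"
      unfolding V1_def i7 *(2-4)[symmetric] by auto
    then have "card (F \<inter> ((V1 \<union> W1 \<union> W2 \<union> W3) - V \<union> {p, q, r})) \<le> card (?A \<union> ?B \<union> ?C \<union> ?D)"
      by (rule card_mono[rotated]) (use b1(4) b2(4) b3(4) in auto)
    also have "\<dots> \<le> card ?A + card ?B + card ?C + card ?D"
      using card_Un_le[of "?A \<union> ?B \<union> ?C" ?D] card_Un_le[of "?A \<union> ?B" ?C] card_Un_le[of ?A ?B] by linarith
    also have "card ?A = (if \<phi> 3 \<in> F then 1 else 0)" by simp
    finally show "card (F \<inter> ((V1 \<union> W1 \<union> W2 \<union> W3) - V \<union> {p, q, r})) \<le> 25"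
      using c1 c2 c3 v by (auto split: if_splits)
  qed
qed

text \<open>The first copy uses the initial triangle; every later one starts with three
vertices in an arbitrary face of its predecessor, so all copies are disjoint.\<close>

lemma family:
  assumes "1 \<le> k"
  shows "\<exists>pos (V :: nat set) E T R. triangulated pos V E T R \<and> card V = 52 * k \<and>
    (\<forall>F. acyclic_on E F \<longrightarrow> card (F \<inter> V) \<le> 25 * k)"
  using assms
proof (induction k rule: dec_induct)
  case base
  define pos :: "nat \<Rightarrow> complex" where "pos = (\<lambda>i. if i = 0 then 0 else if i = 1 then 1 else \<i>)"
  have "\<not> collinear {0, 1, \<i>}"
    unfolding collinear_lemma by (auto simp: complex_eq_iff)
  then have "\<not> collinear {pos 0, pos 1, pos 2}" by (simp add: pos_def)
  then have tr: "triangulated pos {0, 1, 2} {{0, 1}, {1, 2}, {0, 2}} {{0, 1, 2}} {0, 1, 2}"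
    by (rule triangle_triangulated) simp_all
  obtain pos' V' E' T' where u: "triangulated pos' V' E' T' {0, 1, 2::nat}" "{0, 1, 2} \<subseteq> V'"
    "card V' = card {0, 1, 2::nat} + 49"
    "\<And>E'' F. E' \<subseteq> E'' \<Longrightarrow> acyclic_on E'' F \<Longrightarrow> card (F \<inter> (V' - {0, 1, 2} \<union> {0, 1, 2})) \<le> 25"
  proof (rule insert_unit[OF tr singletonI], goal_cases)
    case (1 pos' V' E' T')
    show ?case by (rule 1(1)[OF 1(2,3,4) 1(6)])
  qed
  have "V' - {0, 1, 2} \<union> {0, 1, 2} = V'" using u(2) by blast
  then have "card (F \<inter> V') \<le> 25" if "acyclic_on E' F" for F using u(4)[OF subset_refl that] by simp
  then have "\<forall>F. acyclic_on E' F \<longrightarrow> card (F \<inter> V') \<le> 25 * 1" by simp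
  moreover have "card V' = 52 * 1" using u(3) by simp
  ultimately show ?case using u(1) by blast
next
  case (step k)
  then obtain pos and V :: "nat set" and E T R where tr: "triangulated pos V E T R" and cV: "card V = 52 * k"
    and b: "\<And>F. acyclic_on E F \<Longrightarrow> card (F \<inter> V) \<le> 25 * k" by metis
  interpret triangulated pos V E T R by (rule tr)
  have "R \<noteq> {}" using rim(1) by auto
  then have "T \<noteq> {}" using cover by (auto simp: hull_of_def)
  then obtain t where t: "t \<in> T" by blast
  obtain x y z where "t = {x, y, z}" using face[OF t] card_3_iff by metis
  then have t: "{x, y, z} \<in> T" using t by simp
  obtain pos1 and \<phi> :: "nat \<Rightarrow> nat" and E1 T1 where *: "triangulated pos1 (V \<union> \<phi> ` {3..<6}) E1 T1 R"
    "inj_on \<phi> {..<6}" "\<phi> ` {3..<6} \<inter> V = {}" "E \<subseteq> E1" "\<And>t. t \<in> set [[3,4,5]] \<Longrightarrow> \<phi> ` set t \<in> T1"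
  proof (rule insert_fresh[OF tr t collar_draws, of 27], goal_cases)
    case (4 pos' \<phi> E' T')
    show ?case by (rule 4(1)[OF 4(2,6,7,8,11)])
  qed simp_all
  have T1: "{\<phi> 3, \<phi> 4, \<phi> 5} \<in> T1" using *(5)[of "[3,4,5]"] by simp
  obtain pos2 V2 E2 T2 where u: "triangulated pos2 V2 E2 T2 R" "V \<union> \<phi> ` {3..<6} \<subseteq> V2"
    "card V2 = card (V \<union> \<phi> ` {3..<6}) + 49" "E1 \<subseteq> E2"
    "\<And>E'' F. E2 \<subseteq> E'' \<Longrightarrow> acyclic_on E'' F \<Longrightarrow> card (F \<inter> (V2 - (V \<union> \<phi> ` {3..<6}) \<union> {\<phi> 3, \<phi> 4, \<phi> 5})) \<le> 25"
  proof (rule insert_unit[OF *(1) T1], goal_cases)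
    case (1 pos' V' E' T')
    show ?case by (rule 1(1)[OF 1(2-6)])
  qed
  have "inj_on \<phi> {3..<6}" by (rule inj_on_subset[OF *(2)]) auto
  then have "card (\<phi> ` {3..<6}) = 3" by (simp add: card_image)
  then have "card (V \<union> \<phi> ` {3..<6}) = card V + 3" using *(3) finite_V by (subst card_Un_disjoint) auto
  then have c2: "card V2 = 52 * Suc k" using u(3) cV by simp
  have fin2: "finite V2" using u(1) by (simp add: triangulated_def)
  have "card (F \<inter> V2) \<le> 25 * Suc k" if F: "acyclic_on E2 F" for F
  proof -
    let ?N = "V2 - (V \<union> \<phi> ` {3..<6}) \<union> {\<phi> 3, \<phi> 4, \<phi> 5}"
    have "{3..<6} = {3, 4, 5::nat}" by auto
    then have "F \<inter> V2 \<subseteq> (F \<inter> V) \<union> (F \<inter> ?N)" by auto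
    then have "card (F \<inter> V2) \<le> card ((F \<inter> V) \<union> (F \<inter> ?N))"
      by (rule card_mono[rotated]) (use finite_V fin2 in auto)
    also have "\<dots> \<le> card (F \<inter> V) + card (F \<inter> ?N)" by (rule card_Un_le)
    also have "card (F \<inter> V) \<le> 25 * k"
      by (rule b[OF acyclic_on_subset[OF F]]) (use *(4) u(4) in blast)
    also have "card (F \<inter> ?N) \<le> 25" by (rule u(5)[OF subset_refl F])
    finally show ?thesis by simp
  qed
  then show ?case using u(1) c2 by blast
qed

lemma forest_card_bound:
  assumes "finite V" "\<And>F. F \<subseteq> V \<Longrightarrow> forest (induced (V, E) F) \<Longrightarrow> card F \<le> m"
  shows "max_forest (V, E) \<le> m" "max_forest_deg d (V, E) \<le> m"
proof -
  have 0: "forest (induced (V, E) {})" by (auto simp: forest_def is_cycle_def induced_def)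
  have "finite {card F | F. F \<subseteq> V \<and> P F}" for P
    by (rule finite_subset[of _ "card ` Pow V"]) (use assms(1) in auto)
  note fin = this
  show "max_forest (V, E) \<le> m"
    unfolding max_forest_def fst_conv
    by (rule Max.boundedI) (use assms(2) fin 0 in auto)
  show "max_forest_deg d (V, E) \<le> m"
    unfolding max_forest_deg_def fst_conv
    by (rule Max.boundedI) (use assms(2) fin 0 in auto)
qed

theorem triangulation_family:
  assumes "1 \<le> k"
  shows "\<exists>G :: nat ugraph. planar_triangulation G \<and> card (verts G) = 52 * k \<and> max_forest G \<le> 25 * k \<and>
    (\<forall>d. max_forest_deg d G \<le> 25 * k)"
proof -
  obtain pos and V :: "nat set" and E T R where tr: "triangulated pos V E T R" and c: "card V = 52 * k"
    and b: "\<forall>F. acyclic_on E F \<longrightarrow> card (F \<inter> V) \<le> 25 * k"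
    using family[OF assms] by blast
  have fin: "finite V" using tr by (simp add: triangulated_def)
  have "card F \<le> 25 * k" if "F \<subseteq> V" "forest (induced (V, E) F)" for F
    using b forest_acyclic_on[OF that(2)] that(1) by (metis inf.absorb_iff1)
  from forest_card_bound[OF fin this] show ?thesis
    using triangulated_planar_triangulation[OF tr] c by (intro exI[of _ "(V, E)"]) simp
qed

lemma conjecture_bound:
  assumes "7 \<le> d" "1 \<le> k"
  shows "25 * real k < 2 * real d * (52 * real k) / (4 * real d + 1)"
proof -
  have "25 * (4 * real d + 1) < 2 * real d * 52" using assms(1) by simp
  then have "25 * (4 * real d + 1) * real k < 2 * real d * 52 * real k"
    using assms(2) by (intro mult_strict_right_mono) auto
  then show ?thesis by (simp add: less_divide_eq algebra_simps)
qed

theorem mainTheorem7: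
  shows "(\<forall>k::nat. k \<ge> 1 \<longrightarrow>
            (\<exists>G :: nat ugraph.
               planar_triangulation G \<and> card (verts G) = 52 * k \<and> max_forest G \<le> 25 * k \<and>
               (\<forall>d::nat. d \<ge> 7 \<longrightarrow>
                  max_forest_deg d G \<le> 25 * k \<and>
                  25 * real k < 2 * real d * (52 * real k) / (4 * real d + 1))))
       \<and> (\<forall>d::nat. d \<ge> 7 \<longrightarrow>
            (\<exists>S :: nat ugraph set.
               infinite S \<and>
               pairwise (\<lambda>G H. \<not> graph_iso G H) S \<and>
               (\<forall>G\<in>S. planar G \<and>
                  \<not> real (max_forest_deg d G) > 2 * real d * real (card (verts G)) / (4 * real d + 1))))"
proof (intro conjI allI impI)
  fix k :: nat assume k: "1 \<le> k"
  then show "\<exists>G :: nat ugraph.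
               planar_triangulation G \<and> card (verts G) = 52 * k \<and> max_forest G \<le> 25 * k \<and>
               (\<forall>d::nat. d \<ge> 7 \<longrightarrow>
                  max_forest_deg d G \<le> 25 * k \<and>
                  25 * real k < 2 * real d * (52 * real k) / (4 * real d + 1))"
    using triangulation_family[OF k] conjecture_bound[OF _ k] by blast
next
  fix d :: nat assume d: "7 \<le> d"
  obtain g :: "nat \<Rightarrow> nat ugraph" where g: "\<And>k. 1 \<le> k \<Longrightarrow> planar_triangulation (g k) \<and>
      card (verts (g k)) = 52 * k \<and> max_forest_deg d (g k) \<le> 25 * k"
    using triangulation_family by metis
  have card_g: "card (verts (g k)) = 52 * k" if "1 \<le> k" for k using g[OF that] by simp
  let ?S = "g ` {1..}"
  have "inj_on g {1..}" by (rule inj_onI) (metis atLeast_iff card_g mult_cancel1 zero_neq_numeral)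
  then have "infinite ?S" using finite_imageD infinite_Ici by blast
  moreover have "pairwise (\<lambda>G H. \<not> graph_iso G H) ?S"
  proof (rule pairwiseI)
    fix G H assume "G \<in> ?S" "H \<in> ?S" "G \<noteq> H"
    then have "card (verts G) \<noteq> card (verts H)" using card_g by auto
    then show "\<not> graph_iso G H" unfolding graph_iso_def using bij_betw_same_card by blast
  qed
  moreover have "planar G \<and> \<not> real (max_forest_deg d G) > 2 * real d * real (card (verts G)) / (4 * real d + 1)"
    if G: "G \<in> ?S" for G
  proof -
    obtain k where k: "1 \<le> k" "G = g k" using G by auto
    have "planar G" using g[OF k(1)] unfolding k(2) planar_def planar_triangulation_def by blast
    moreover have "real (max_forest_deg d G) \<le> 25 * real k" using g[OF k(1)] unfolding k(2)
      by (metis of_nat_le_iff of_nat_mult of_nat_numeral)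
    then have "real (max_forest_deg d G) \<le> 2 * real d * real (card (verts G)) / (4 * real d + 1)"
      using conjecture_bound[OF d k(1)] card_g[OF k(1)] unfolding k(2) by simp
    ultimately show ?thesis by simp
  qed
  ultimately show "\<exists>S :: nat ugraph set. infinite S \<and> pairwise (\<lambda>G H. \<not> graph_iso G H) S \<and>
      (\<forall>G\<in>S. planar G \<and> \<not> real (max_forest_deg d G) > 2 * real d * real (card (verts G)) / (4 * real d + 1))"
    by blast
qed

end
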